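(* Let $d\in\mathbb{N}$, $\Omega\subset\mathbb{R}^d$ open and bounded, and $\lambda_1,\Lambda,\varepsilon_0>0$. Consider a family $A_\varepsilon:\mathrm{sint}_\varepsilon\Omega\to\mathbb{R}^{d\times\mathcal{R}\times d\times\mathcal{R}}$, $0<\varepsilon\le\varepsilon_0$, with $\lambda_{\rm atom}(A_\varepsilon(x))\ge\lambda_1$ for all $x\in\mathrm{sint}_\varepsilon\Omega$ and $0<\varepsilon\le\varepsilon_0$. Assume also that $\sup_\varepsilon\lVert A_\varepsilon\rVert_\infty\le\Lambda$ and that there are $r_\varepsilon\ge\varepsilon$ such that \[\sup_{0<\varepsilon\le\varepsilon_0}\ \sup_{\substack{x,x'\in\mathrm{sint}_\varepsilon\Omega\\|x-x'|\le2r_\varepsilon+2\varepsilon R_{\max}}}|A_\varepsilon(x)-A_\varepsilon(x')|\le\frac{\lambda_1}{4}.\] Then there is a $\lambda_2=\lambda_2(\lambda_1,\Lambda,d,\mathcal{R})$ (depending only on these quantities) such that \[\varepsilon^d\sum_{x\in\mathrm{sint}_\varepsilon\Omega}A_\varepsilon(x)[D_{\mathcal{R},\varepsilon}u(x),D_{\mathcal{R},\varepsilon}u(x)]\ge\frac{\lambda_1}{2}\lVert u\rVert^2_{h^1_\varepsilon(\mathrm{sint}_\varepsilon\Omega)}-\frac{\lambda_2}{r_\varepsilon^2}\lVert u\rVert^2_{\ell^2_\varepsilon(\mathrm{int}_\varepsilon\Omega)}\] for all $u\in\mathcal{A}_\varepsilon(\Omega,0)$ and $0<\varepsilon\le\v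arepsilon_0$.
   Context: $\mathcal{R}\subset\mathbb{Z}^d\setminus\{0\}$ is a fixed finite set with $\mathrm{span}_{\mathbb{Z}}\mathcal{R}=\mathbb{Z}^d$ and $\mathcal{R}=-\mathcal{R}$; $\mathbb{R}^{d\times\mathcal{R}}\cong(\mathbb{R}^d)^{\mathcal{R}}$, and $|\cdot|$ denotes Euclidean norms. A tensor $K\in\mathbb{R}^{d\times\mathcal{R}\times d\times\mathcal{R}}$ is viewed as a bilinear form $K[M,N]$ on $\mathbb{R}^{d\times\mathcal{R}}$; $\lVert A_\varepsilon\rVert_\infty=\sup_{x}|A_\varepsilon(x)|$. For $\varepsilon>0$, $D_{\mathcal{R},\varepsilon}y(x)=\big(\frac{y(x+\varepsilon\rho)-y(x)}{\varepsilon}\big)_{\rho\in\mathcal{R}}$. With $R_{\max}=\max\{|\rho|:\rho\in\mathcal{R}\}$ and $R_0=\max\{R_{\max},\frac{\sqrt d}{4}\}$ set $\mathrm{sint}_\varepsilon\Omega=\{x\in\Omega\cap\varepsilon\mathbb{Z}^d:\mathrm{dist}(x,\partial\Omega)>\varepsilon R_0\}$, $\mathrm{int}_\varepsilon\Omega=\{x\in\Omega\cap\varepsilon\mathbb{Z}^d:\mathrm{dist}(x,\partial\Omega)>2\varepsilon R_0\}$, $\partial_\varepsilon\Omega=(\Omega\cap\varepsilon\mathbb{Z}^d)\setminus\mathrm{int}_\varepsilon\Omega$, and $\mathcal{A}_\varepsilon(\Omega,0)=\{y:\Omega\cap\varepsilon\mathbb{Z}^d\to\mathbb{R}^d: y=0\text{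 on }\partial_\varepsilon\Omega\}$. Norms: $\lVert y\rVert^2_{\ell^2_\varepsilon(\mathrm{int}_\varepsilon\Omega)}=\varepsilon^d\sum_{x\in\mathrm{int}_\varepsilon\Omega}|y(x)|^2$, $\lVert y\rVert^2_{h^1_\varepsilon(\mathrm{sint}_\varepsilon\Omega)}=\varepsilon^d\sum_{x\in\mathrm{sint}_\varepsilon\Omega}|D_{\mathcal{R},\varepsilon}y(x)|^2$. Atomistic stability constant: for $K\in\mathbb{R}^{d\times\mathcal{R}\times d\times\mathcal{R}}$ and bounded open nonempty $U\subset\mathbb{R}^d$, \[\lambda_\varepsilon(K,U)=\inf_{y\in\mathcal{A}_\varepsilon(U,0),\,y\ne0}\frac{\varepsilon^d\sum_{x\in\mathrm{sint}_\varepsilon U}K[D_{\mathcal{R},\varepsilon}y(x),D_{\mathcal{R},\varepsilon}y(x)]}{\varepsilon^d\sum_{x\in\mathrm{sint}_\varepsilon U}|D_{\mathcal{R},\varepsilon}y(x)|^2},\qquad\lambda_{\rm atom}(K)=\lim_{\varepsilon\to0}\lambda_\varepsilon(K,U)=\inf_{\varepsilon>0}\lambda_\varepsilon(K,U).\] The limit exists, equals the infimum and is independent of $U$ (known). *)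

theory Defs
  imports "HOL-Analysis.Analysis"
begin

interpretation int_vec: module "(*s) :: int \<Rightarrow> int ^ 'n \<Rightarrow> int ^ 'n"
  by unfold_locales (simp_all add: vec_eq_iff algebra_simps)

definition real_vec :: "int ^ 'd \<Rightarrow> real ^ 'd" where
  "real_vec z = (\<chi> i. real_of_int (z $ i))"

definition lattice :: "real \<Rightarrow> (real ^ 'd) set" where
  "lattice \<epsilon> = range (\<lambda>z. \<epsilon> *\<^sub>R real_vec z)"

definition R_max :: "(int ^ 'd) set \<Rightarrow> real" where
  "R_max R = Max ((\<lambda>\<rho>. norm (real_vec \<rho>)) ` R)"

definition R_0 :: "(int ^ 'd) set \<Rightarrow> real" where
  "R_0 R = max (R_max R) (sqrt (real CARD('d)) / 4)"

definition sint :: "(int ^ 'd) set \<Rightarrow> real \<Rightarrow> (real ^ 'd) set \<Rightarrow> (real ^ 'd) set" where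
  "sint R \<epsilon> \<Omega> = {x \<in> \<Omega> \<inter> lattice \<epsilon>. infdist x (frontier \<Omega>) > \<epsilon> * R_0 R}"

definition dint :: "(int ^ 'd) set \<Rightarrow> real \<Rightarrow> (real ^ 'd) set \<Rightarrow> (real ^ 'd) set" where
  "dint R \<epsilon> \<Omega> = {x \<in> \<Omega> \<inter> lattice \<epsilon>. infdist x (frontier \<Omega>) > 2 * \<epsilon> * R_0 R}"

definition dbdry :: "(int ^ 'd) set \<Rightarrow> real \<Rightarrow> (real ^ 'd) set \<Rightarrow> (real ^ 'd) set" where
  "dbdry R \<epsilon> \<Omega> = (\<Omega> \<inter> lattice \<epsilon>) - dint R \<epsilon> \<Omega>"

text \<open>Maps on \<open>\<Omega> \<inter> lattice \<epsilon>\<close> are represented by total functions whose values off that set are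
  arbitrary. These values never matter: the norms and energies below evaluate finite differences
  only on \<open>sint R \<epsilon> \<Omega>\<close>, from where every step in \<open>R\<close> stays inside \<open>\<Omega>\<close>.\<close>

definition A0 :: "(int ^ 'd) set \<Rightarrow> real \<Rightarrow> (real ^ 'd) set \<Rightarrow> (real ^ 'd \<Rightarrow> real ^ 'd) set" where
  "A0 R \<epsilon> \<Omega> = {y. \<forall>x\<in>dbdry R \<epsilon> \<Omega>. y x = 0}"

text \<open>An element of \<open>(\<real>\<^sup>d)\<^sup>R\<close> is a function \<open>int ^ 'd \<Rightarrow> real ^ 'd\<close> read only on \<open>R\<close>; likewise, the
  entry of a tensor \<open>K\<close> at \<open>(i, \<rho>, j, \<sigma>)\<close> is \<open>K i \<rho> j \<sigma>\<close>, read only for \<open>\<rho>\<close> and \<open>\<sigma>\<close> in \<open>R\<close>.\<close>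

type_synonym 'd tensor = "'d \<Rightarrow> int ^ 'd \<Rightarrow> 'd \<Rightarrow> int ^ 'd \<Rightarrow> real"

definition D :: "real \<Rightarrow> (real ^ 'd \<Rightarrow> real ^ 'd) \<Rightarrow> real ^ 'd \<Rightarrow> int ^ 'd \<Rightarrow> real ^ 'd" where
  "D \<epsilon> y x = (\<lambda>\<rho>. (y (x + \<epsilon> *\<^sub>R real_vec \<rho>) - y x) /\<^sub>R \<epsilon>)"

definition norm_R :: "(int ^ 'd) set \<Rightarrow> (int ^ 'd \<Rightarrow> real ^ 'd) \<Rightarrow> real" where
  "norm_R R M = sqrt (\<Sum>\<rho>\<in>R. (norm (M \<rho>))\<^sup>2)"

definition tensor_norm :: "(int ^ 'd) set \<Rightarrow> 'd::finite tensor \<Rightarrow> real" where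
  "tensor_norm R K = sqrt (\<Sum>i\<in>UNIV. \<Sum>\<rho>\<in>R. \<Sum>j\<in>UNIV. \<Sum>\<sigma>\<in>R. (K i \<rho> j \<sigma>)\<^sup>2)"

definition bilin ::
  "(int ^ 'd) set \<Rightarrow> 'd::finite tensor \<Rightarrow> (int ^ 'd \<Rightarrow> real ^ 'd) \<Rightarrow> (int ^ 'd \<Rightarrow> real ^ 'd) \<Rightarrow> real" where
  "bilin R K M N = (\<Sum>i\<in>UNIV. \<Sum>\<rho>\<in>R. \<Sum>j\<in>UNIV. \<Sum>\<sigma>\<in>R. K i \<rho> j \<sigma> * M \<rho> $ i * N \<sigma> $ j)"

definition l2_norm ::
  "(int ^ 'd) set \<Rightarrow> real \<Rightarrow> (real ^ 'd) set \<Rightarrow> (real ^ 'd \<Rightarrow> real ^ 'd) \<Rightarrow> real" where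
  "l2_norm R \<epsilon> \<Omega> y = sqrt (\<epsilon> ^ CARD('d) * (\<Sum>x\<in>dint R \<epsilon> \<Omega>. (norm (y x))\<^sup>2))"

definition h1_norm ::
  "(int ^ 'd) set \<Rightarrow> real \<Rightarrow> (real ^ 'd) set \<Rightarrow> (real ^ 'd \<Rightarrow> real ^ 'd) \<Rightarrow> real" where
  "h1_norm R \<epsilon> \<Omega> y = sqrt (\<epsilon> ^ CARD('d) * (\<Sum>x\<in>sint R \<epsilon> \<Omega>. (norm_R R (D \<epsilon> y x))\<^sup>2))"

text \<open>The infimum is taken in \<open>ereal\<close>, so that it is \<open>\<infinity>\<close> when \<open>A0 R \<epsilon> U\<close> contains only the zero map
  (which happens for large \<open>\<epsilon>\<close>).\<close>

definition lambda_eps ::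
  "(int ^ 'd) set \<Rightarrow> real \<Rightarrow> 'd::finite tensor \<Rightarrow> (real ^ 'd) set \<Rightarrow> ereal" where
  "lambda_eps R \<epsilon> K U =
    (INF y\<in>{y \<in> A0 R \<epsilon> U. \<exists>x\<in>U \<inter> lattice \<epsilon>. y x \<noteq> 0}.
      ereal ((\<epsilon> ^ CARD('d) * (\<Sum>x\<in>sint R \<epsilon> U. bilin R K (D \<epsilon> y x) (D \<epsilon> y x))) /
             (\<epsilon> ^ CARD('d) * (\<Sum>x\<in>sint R \<epsilon> U. (norm_R R (D \<epsilon> y x))\<^sup>2))))"

text \<open>The common limit over all \<open>U\<close>; lemmas \<open>lambda_atom_tendsto\<close> and \<open>lambda_atom_eq_INF\<close> show that it
  exists and equals the infimum over \<open>\<epsilon>\<close>.\<close>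

definition lambda_atom :: "(int ^ 'd) set \<Rightarrow> 'd::finite tensor \<Rightarrow> ereal" where
  "lambda_atom R K = (THE l. \<forall>U. open U \<and> bounded U \<and> U \<noteq> {} \<longrightarrow>
     ((\<lambda>\<epsilon>. lambda_eps R \<epsilon> K U) \<longlongrightarrow> l) (at_right 0))"

lemma real_vec_simps [simp]:
  "real_vec (a + b) = real_vec a + real_vec b" "real_vec (a - b) = real_vec a - real_vec b"
  "real_vec a = real_vec b \<longleftrightarrow> a = b"
  by (simp_all add: real_vec_def vec_eq_iff)

lemma R_max_ge:
  assumes "finite R" "\<rho> \<in> R"
  shows "norm (real_vec \<rho>) \<le> R_max R"
  using assms by (auto simp: R_max_def intro!: Max_ge)

lemma R_0_pos: "R_0 (R :: (int ^ 'd::finite) set) > 0"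
  by (simp add: R_0_def less_max_iff_disj)

lemma step_le:
  assumes "finite R" "\<rho> \<in> R" "\<epsilon> > 0"
  shows "norm (\<epsilon> *\<^sub>R real_vec \<rho>) \<le> \<epsilon> * R_0 R"
  using R_max_ge[OF assms(1,2)] assms(3) by (simp add: R_0_def)

lemma step_in:
  fixes x v :: "real ^ 'd::finite"
  assumes x: "x \<in> U" and v: "norm v < infdist x (frontier U)"
  shows "x + v \<in> U"
proof (rule ccontr)
  assume "x + v \<notin> U"
  then have "closed_segment x (x + v) \<inter> frontier U \<noteq> {}"
    using x by (intro connected_Int_frontier) auto
  then obtain p where p: "p \<in> closed_segment x (x + v)" "p \<in> frontier U" by auto
  have "dist p x \<le> norm v"
    using dist_in_closed_segment[OF p(1)] by (simp add: dist_norm)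
  moreover have "infdist x (frontier U) \<le> dist x p"
    using p(2) by (rule infdist_le)
  ultimately show False using v by (simp add: dist_commute)
qed

lemma sint_step_in:
  fixes R :: "(int ^ 'd::finite) set"
  assumes "finite R" "\<rho> \<in> R" "\<epsilon> > 0" "\<epsilon> *\<^sub>R real_vec n \<in> sint R \<epsilon> U"
  shows "\<epsilon> *\<^sub>R real_vec (n + \<rho>) \<in> U \<inter> lattice \<epsilon>"
proof -
  have "\<epsilon> *\<^sub>R real_vec n + \<epsilon> *\<^sub>R real_vec \<rho> \<in> U"
    using assms(4) by (intro step_in le_less_trans[OF step_le[OF assms(1-3)]]) (auto simp: sint_def)
  moreover have "\<epsilon> *\<^sub>R real_vec (n + \<rho>) \<in> lattice \<epsilon>"
    unfolding lattice_def by (rule rangeI)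
  ultimately show ?thesis
    by (simp add: scaleR_right_distrib)
qed

lemma dint_sub_sint:
  fixes R :: "(int ^ 'd::finite) set"
  assumes "\<epsilon> > 0"
  shows "dint R \<epsilon> U \<subseteq> sint R \<epsilon> U"
proof -
  have "\<epsilon> * R_0 R > 0" using assms R_0_pos[of R] by simp
  then show ?thesis unfolding dint_def sint_def by auto
qed

lemma dint_step_sint:
  fixes R :: "(int ^ 'd::finite) set"
  assumes "finite R" "\<rho> \<in> R" "\<epsilon> > 0" "\<epsilon> *\<^sub>R real_vec (n + \<rho>) \<in> dint R \<epsilon> U"
  shows "\<epsilon> *\<^sub>R real_vec n \<in> sint R \<epsilon> U"
proof -
  let ?x = "\<epsilon> *\<^sub>R real_vec n" and ?v = "\<epsilon> *\<^sub>R real_vec \<rho>"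
  have pos: "\<epsilon> * R_0 R > 0" using assms R_0_pos[of R] by simp
  have xv: "?x + ?v \<in> U" "infdist (?x + ?v) (frontier U) > 2 * \<epsilon> * R_0 R"
    using assms(4) by (auto simp: dint_def scaleR_right_distrib)
  have v: "norm ?v \<le> \<epsilon> * R_0 R" using step_le[OF assms(1-3)] .
  have "(?x + ?v) + (- ?v) \<in> U"
  proof (rule step_in)
    show "norm (- ?v) < infdist (?x + ?v) (frontier U)"
      unfolding norm_minus_cancel using xv(2) v pos by linarith
  qed (rule xv(1))
  moreover have "infdist (?x + ?v) (frontier U) \<le> infdist ?x (frontier U) + norm ?v"
    using infdist_triangle[of "?x + ?v" "frontier U" ?x] by (simp add: dist_norm)
  ultimately show ?thesis
    using xv(2) v unfolding sint_def lattice_def by auto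
qed

text \<open>Rescaled Rayleigh quotient of a finitely supported \<open>z\<close> on the integer lattice.\<close>

definition dz :: "(int ^ 'd \<Rightarrow> real ^ 'd) \<Rightarrow> int ^ 'd \<Rightarrow> int ^ 'd \<Rightarrow> real ^ 'd" where
  "dz z n = (\<lambda>\<rho>. z (n + \<rho>) - z n)"

definition rq :: "(int ^ 'd) set \<Rightarrow> 'd::finite tensor \<Rightarrow> (int ^ 'd \<Rightarrow> real ^ 'd) \<Rightarrow> real" where
  "rq R K z = (let N = {n. \<exists>\<rho>\<in>R. dz z n \<rho> \<noteq> 0} in
    (\<Sum>n\<in>N. bilin R K (dz z n) (dz z n)) / (\<Sum>n\<in>N. (norm_R R (dz z n))\<^sup>2))"

lemma bilin_scale:
  "bilin R K (\<lambda>\<rho>. c *\<^sub>R M \<rho>) (\<lambda>\<rho>. c *\<^sub>R M \<rho>) = c\<^sup>2 * bilin R K M M"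
  by (simp add: bilin_def sum_distrib_left power2_eq_square mult_ac)

lemma norm_R_scale: "(norm_R R (\<lambda>\<rho>. c *\<^sub>R M \<rho>))\<^sup>2 = c\<^sup>2 * (norm_R R M)\<^sup>2"
  by (simp add: norm_R_def sum_nonneg power_mult_distrib sum_distrib_left)

lemma bilin_cong: "(\<And>\<rho>. \<rho> \<in> R \<Longrightarrow> M \<rho> = M' \<rho>) \<Longrightarrow> bilin R K M M = bilin R K M' M'"
  by (auto simp: bilin_def intro!: sum.cong)

lemma norm_R_cong: "(\<And>\<rho>. \<rho> \<in> R \<Longrightarrow> M \<rho> = M' \<rho>) \<Longrightarrow> norm_R R M = norm_R R M'"
  by (auto simp: norm_R_def intro!: sum.cong)

lemma finite_rescaled:
  fixes U :: "(real ^ 'd::finite) set"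
  assumes "bounded U" "\<epsilon> > 0"
  shows "finite {n. \<epsilon> *\<^sub>R real_vec n \<in> U}"
proof -
  obtain B where B: "\<And>x. x \<in> U \<Longrightarrow> norm x \<le> B"
    using assms(1) by (auto simp: bounded_iff)
  let ?k = "\<lceil>B / \<epsilon>\<rceil>"
  have "{n. \<epsilon> *\<^sub>R real_vec n \<in> U} \<subseteq> {n. \<forall>i. n $ i \<in> {- ?k..?k}}"
  proof safe
    fix n :: "int ^ 'd" and i
    assume "\<epsilon> *\<^sub>R real_vec n \<in> U"
    then have "\<bar>(\<epsilon> *\<^sub>R real_vec n) $ i\<bar> \<le> B"
      using B component_le_norm_cart order_trans by blast
    then have "\<bar>real_of_int (n $ i)\<bar> \<le> B / \<epsilon>"
      using assms(2) by (simp add: real_vec_def abs_mult field_simps)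
    then show "n $ i \<in> {- ?k..?k}" by simp linarith
  qed
  moreover have "finite {n :: int ^ 'd. \<forall>i. n $ i \<in> {- ?k..?k}}"
  proof (rule finite_subset)
    show "{n :: int ^ 'd. \<forall>i. n $ i \<in> {- ?k..?k}} \<subseteq> vec_lambda ` (UNIV \<rightarrow>\<^sub>E {- ?k..?k})"
    proof
      fix n :: "int ^ 'd" assume "n \<in> {n. \<forall>i. n $ i \<in> {- ?k..?k}}"
      then have "vec_nth n \<in> UNIV \<rightarrow>\<^sub>E {- ?k..?k}" by (auto simp: PiE_def)
      then show "n \<in> vec_lambda ` (UNIV \<rightarrow>\<^sub>E {- ?k..?k})" by (metis image_eqI vec_nth_inverse)
    qed
    show "finite (vec_lambda ` ((UNIV :: 'd set) \<rightarrow>\<^sub>E {- ?k..?k}))"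
      by (intro finite_imageI finite_PiE) auto
  qed
  ultimately show ?thesis by (rule finite_subset)
qed

lemma quotient_eq_rq:
  fixes R :: "(int ^ 'd::finite) set"
  assumes R: "finite R" and e: "\<epsilon> > 0" and U: "bounded U"
    and supp: "\<And>n. z n \<noteq> 0 \<Longrightarrow> \<epsilon> *\<^sub>R real_vec n \<in> dint R \<epsilon> U"
    and y: "\<And>n. \<epsilon> *\<^sub>R real_vec n \<in> U \<Longrightarrow> y (\<epsilon> *\<^sub>R real_vec n) = z n"
  shows "(\<epsilon> ^ CARD('d) * (\<Sum>x\<in>sint R \<epsilon> U. bilin R K (D \<epsilon> y x) (D \<epsilon> y x))) /
     (\<epsilon> ^ CARD('d) * (\<Sum>x\<in>sint R \<epsilon> U. (norm_R R (D \<epsilon> y x))\<^sup>2)) = rq R K z"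
proof -
  let ?e = "\<lambda>n :: int ^ 'd. \<epsilon> *\<^sub>R real_vec n"
  define S where "S = {n. ?e n \<in> sint R \<epsilon> U}"
  define N where "N = {n. \<exists>\<rho>\<in>R. dz z n \<rho> \<noteq> 0}"
  have S: "sint R \<epsilon> U = ?e ` S"
    by (auto simp: S_def sint_def lattice_def)
  have inj: "inj_on ?e S" using e by (auto simp: inj_on_def)
  have finS: "finite S"
    by (rule finite_subset[OF _ finite_rescaled[OF U e]]) (auto simp: S_def sint_def)
  have NS: "N \<subseteq> S"
  proof
    fix n assume "n \<in> N"
    then obtain \<rho> where r: "\<rho> \<in> R" "z (n + \<rho>) \<noteq> z n" by (auto simp: N_def dz_def)
    then consider "z n \<noteq> 0" | "z (n + \<rho>) \<noteq> 0" by metis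
    then show "n \<in> S"
    proof cases
      case 1
      then show ?thesis using supp dint_sub_sint[OF e] by (auto simp: S_def)
    next
      case 2
      then show ?thesis using dint_step_sint[OF R r(1) e supp] by (simp add: S_def)
    qed
  qed
  have Dy: "D \<epsilon> y (?e n) \<rho> = inverse \<epsilon> *\<^sub>R dz z n \<rho>" if "n \<in> S" "\<rho> \<in> R" for n \<rho>
  proof -
    have "?e (n + \<rho>) \<in> U" "?e n \<in> U"
      using sint_step_in[OF R that(2) e, of n U] that(1) by (auto simp: S_def sint_def)
    then show ?thesis
      using y[of n] y[of "n + \<rho>"] by (simp add: D_def dz_def scaleR_right_distrib)
  qed
  have 1: "bilin R K (D \<epsilon> y (?e n)) (D \<epsilon> y (?e n)) = (inverse \<epsilon>)\<^sup>2 * bilin R K (dz z n) (dz z n)"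
    if "n \<in> S" for n
    unfolding bilin_scale[symmetric] using Dy[OF that] by (rule bilin_cong)
  have 2: "(norm_R R (D \<epsilon> y (?e n)))\<^sup>2 = (inverse \<epsilon>)\<^sup>2 * (norm_R R (dz z n))\<^sup>2"
    if "n \<in> S" for n
    unfolding norm_R_scale[symmetric] using norm_R_cong[of R, OF Dy[OF that]] by simp
  have z0: "dz z n \<rho> = 0" if "n \<notin> N" "\<rho> \<in> R" for n \<rho>
    using that by (auto simp: N_def)
  have 3: "(\<Sum>n\<in>S. bilin R K (dz z n) (dz z n)) = (\<Sum>n\<in>N. bilin R K (dz z n) (dz z n))"
    using finS NS z0 by (intro sum.mono_neutral_right) (auto simp: bilin_def)
  have 4: "(\<Sum>n\<in>S. (norm_R R (dz z n))\<^sup>2) = (\<Sum>n\<in>N. (norm_R R (dz z n))\<^sup>2)"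
    using finS NS z0 by (intro sum.mono_neutral_right) (auto simp: norm_R_def)
  have "(\<Sum>x\<in>sint R \<epsilon> U. bilin R K (D \<epsilon> y x) (D \<epsilon> y x))
      = (inverse \<epsilon>)\<^sup>2 * (\<Sum>n\<in>N. bilin R K (dz z n) (dz z n))"
    unfolding S sum.reindex[OF inj] by (simp add: 1 3 flip: sum_distrib_left)
  moreover have "(\<Sum>x\<in>sint R \<epsilon> U. (norm_R R (D \<epsilon> y x))\<^sup>2)
      = (inverse \<epsilon>)\<^sup>2 * (\<Sum>n\<in>N. (norm_R R (dz z n))\<^sup>2)"
    unfolding S sum.reindex[OF inj] by (simp add: 2 4 flip: sum_distrib_left)
  ultimately show ?thesis
    using e by (simp add: rq_def Let_def flip: N_def)
qed

lemma lambda_eps_eq_INF: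
  fixes R :: "(int ^ 'd::finite) set"
  assumes R: "finite R" and e: "\<epsilon> > 0" and U: "bounded U"
  shows "lambda_eps R \<epsilon> K U =
    (INF z\<in>{z. (\<exists>n. z n \<noteq> 0) \<and> (\<forall>n. z n \<noteq> 0 \<longrightarrow> \<epsilon> *\<^sub>R real_vec n \<in> dint R \<epsilon> U)}. ereal (rq R K z))"
    (is "_ = (INF z\<in>?P. _)")
proof (rule antisym)
  show "lambda_eps R \<epsilon> K U \<le> (INF z\<in>?P. ereal (rq R K z))"
  proof (rule INF_greatest)
    fix z assume z: "z \<in> ?P"
    define y where "y x = (if x \<in> lattice \<epsilon> then z (THE n. x = \<epsilon> *\<^sub>R real_vec n) else 0)" for x
    have y: "y (\<epsilon> *\<^sub>R real_vec n) = z n" for n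
      using e by (auto simp: y_def lattice_def)
    have "y \<in> A0 R \<epsilon> U"
      using z by (auto simp: A0_def dbdry_def lattice_def y)
    moreover obtain n where "z n \<noteq> 0" "\<epsilon> *\<^sub>R real_vec n \<in> dint R \<epsilon> U" using z by auto
    ultimately have "y \<in> {y \<in> A0 R \<epsilon> U. \<exists>x\<in>U \<inter> lattice \<epsilon>. y x \<noteq> 0}"
      by (auto simp: dint_def y intro!: bexI[of _ "\<epsilon> *\<^sub>R real_vec n"])
    then show "lambda_eps R \<epsilon> K U \<le> ereal (rq R K z)"
      unfolding lambda_eps_def
      using z by (subst quotient_eq_rq[OF R e U, symmetric, of z y]) (auto simp: y intro: INF_lower)
  qed
  show "(INF z\<in>?P. ereal (rq R K z)) \<le> lambda_eps R \<epsilon> K U"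
    unfolding lambda_eps_def
  proof (rule INF_greatest)
    fix y assume y: "y \<in> {y \<in> A0 R \<epsilon> U. \<exists>x\<in>U \<inter> lattice \<epsilon>. y x \<noteq> 0}"
    define z where "z n = (if \<epsilon> *\<^sub>R real_vec n \<in> U then y (\<epsilon> *\<^sub>R real_vec n) else 0)" for n
    have z: "z \<in> ?P"
      using y by (auto simp: z_def A0_def dbdry_def lattice_def)
    show "(INF z\<in>?P. ereal (rq R K z)) \<le> ereal ((\<epsilon> ^ CARD('d) * (\<Sum>x\<in>sint R \<epsilon> U. bilin R K (D \<epsilon> y x) (D \<epsilon> y x))) /
             (\<epsilon> ^ CARD('d) * (\<Sum>x\<in>sint R \<epsilon> U. (norm_R R (D \<epsilon> y x))\<^sup>2)))"
    proof (subst quotient_eq_rq[OF R e U, of z y])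
      show "(INF z\<in>?P. ereal (rq R K z)) \<le> ereal (rq R K z)" using z by (rule INF_lower)
    qed (use z in \<open>simp_all add: z_def\<close>)
  qed
qed

lemma rq_shift: "rq R K (\<lambda>n. z (n - a)) = rq R K z"
proof -
  have d: "dz (\<lambda>n. z (n - a)) n = dz z (n - a)" for n
    by (simp add: dz_def fun_eq_iff algebra_simps)
  have "(\<Sum>n | \<exists>\<rho>\<in>R. dz z (n - a) \<rho> \<noteq> 0. f (dz z (n - a))) = (\<Sum>n | \<exists>\<rho>\<in>R. dz z n \<rho> \<noteq> 0. f (dz z n))"
    for f :: "_ \<Rightarrow> real"
    by (rule sum.reindex_bij_witness[of _ "\<lambda>n. n + a" "\<lambda>n. n - a"]) auto
  from this[of "\<lambda>M. bilin R K M M"] this[of "\<lambda>M. (norm_R R M)\<^sup>2"]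
  show ?thesis unfolding rq_def Let_def d by simp
qed

lemma eventually_lambda_eps_le:
  fixes R :: "(int ^ 'd::finite) set"
  assumes R: "finite R" and U: "open U" "bounded U" "U \<noteq> {}"
    and z: "finite {n. z n \<noteq> 0}" "\<exists>n. z n \<noteq> 0"
  shows "eventually (\<lambda>\<epsilon>. lambda_eps R \<epsilon> K U \<le> ereal (rq R K z)) (at_right 0)"
proof -
  obtain c r where r: "r > 0" "ball c r \<subseteq> U"
    using U(1,3) open_contains_ball by blast
  obtain B where B: "\<And>n. z n \<noteq> 0 \<Longrightarrow> norm (real_vec n) \<le> B" "B \<ge> 0"
  proof
    show "norm (real_vec n) \<le> (\<Sum>n | z n \<noteq> 0. norm (real_vec n))" if "z n \<noteq> 0" for n
      using z(1) that by (intro member_le_sum) auto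
  qed (auto intro: sum_nonneg)
  have fr: "frontier U \<noteq> {}"
    using U not_bounded_UNIV by (auto simp: frontier_eq_empty)
  have cr: "infdist c (frontier U) \<ge> r"
    unfolding infdist_notempty[OF fr]
  proof (intro cINF_greatest fr)
    fix p assume "p \<in> frontier U"
    then have "p \<notin> ball c r" using r(2) U(1) by (auto simp: frontier_def interior_open)
    then show "r \<le> dist c p" by simp
  qed
  define C where "C = real CARD('d) + B + 2 * R_0 R"
  have C: "C > 0" using B R_0_pos[of R] by (simp add: C_def)
  have "eventually (\<lambda>\<epsilon>. \<epsilon> \<in> {0<..<r / C}) (at_right 0)"
    using r C by (intro eventually_at_right_real) simp
  then show ?thesis
  proof eventually_elim
    case (elim \<epsilon>)
    then have e: "\<epsilon> > 0" and eC: "\<epsilon> * C < r" using C by (auto simp: field_simps)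
    define a :: "int ^ 'd" where "a = (\<chi> i. \<lfloor>c $ i / \<epsilon>\<rfloor>)"
    have "norm (\<epsilon> *\<^sub>R real_vec a - c) \<le> (\<Sum>i\<in>UNIV. \<bar>(\<epsilon> *\<^sub>R real_vec a - c) $ i\<bar>)"
      by (rule norm_le_l1_cart)
    also have "\<dots> \<le> (\<Sum>i\<in>(UNIV :: 'd set). \<epsilon>)"
    proof (rule sum_mono)
      fix i
      define q where "q = c $ i / \<epsilon>"
      have c: "c $ i = \<epsilon> * q" using e by (simp add: q_def)
      have "real_of_int \<lfloor>q\<rfloor> \<le> q" "q \<le> real_of_int \<lfloor>q\<rfloor> + 1"
        by linarith+
      then have "\<epsilon> * real_of_int \<lfloor>q\<rfloor> \<le> \<epsilon> * q" "\<epsilon> * q \<le> \<epsilon> * (real_of_int \<lfloor>q\<rfloor> + 1)"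
        using e by (auto intro!: mult_left_mono)
      then have "\<epsilon> * real_of_int \<lfloor>c $ i / \<epsilon>\<rfloor> \<le> c $ i" "c $ i \<le> \<epsilon> * real_of_int \<lfloor>c $ i / \<epsilon>\<rfloor> + \<epsilon>"
        unfolding q_def[symmetric] c by (simp_all add: distrib_left)
      then show "\<bar>(\<epsilon> *\<^sub>R real_vec a - c) $ i\<bar> \<le> \<epsilon>" by (simp add: a_def real_vec_def abs_le_iff)
    qed
    finally have ac: "norm (\<epsilon> *\<^sub>R real_vec a - c) \<le> \<epsilon> * CARD('d)" by (simp add: mult.commute)
    have "\<epsilon> *\<^sub>R real_vec n \<in> dint R \<epsilon> U" if "z (n - a) \<noteq> 0" for n
    proof -
      let ?x = "\<epsilon> *\<^sub>R real_vec n"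
      have "?x - c = (\<epsilon> *\<^sub>R real_vec a - c) + \<epsilon> *\<^sub>R real_vec (n - a)"
        by (simp add: algebra_simps)
      then have "norm (?x - c) \<le> norm (\<epsilon> *\<^sub>R real_vec a - c) + norm (\<epsilon> *\<^sub>R real_vec (n - a))"
        by (simp only: norm_triangle_ineq)
      also have "\<dots> \<le> \<epsilon> * CARD('d) + \<epsilon> * B"
        using ac B(1)[OF that] e by (auto intro!: add_mono)
      finally have n: "dist c ?x \<le> \<epsilon> * CARD('d) + \<epsilon> * B" by (simp add: dist_norm norm_minus_commute)
      have pos: "\<epsilon> * R_0 R > 0" using e R_0_pos[of R] by simp
      have eq: "\<epsilon> * C = \<epsilon> * CARD('d) + \<epsilon> * B + 2 * \<epsilon> * R_0 R"
        by (simp add: C_def algebra_simps)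
      have "?x \<in> ball c r" using n eC pos eq by simp
      moreover have "r \<le> infdist ?x (frontier U) + dist c ?x"
        using cr infdist_triangle[of c "frontier U" ?x] by simp
      ultimately show ?thesis
        using r n eC eq by (auto simp: dint_def lattice_def)
    qed
    moreover have "\<exists>n. z (n - a) \<noteq> 0"
    proof -
      obtain m where "z m \<noteq> 0" using z(2) by blast
      then have "z ((m + a) - a) \<noteq> 0" by simp
      then show ?thesis by blast
    qed
    ultimately have "lambda_eps R \<epsilon> K U \<le> ereal (rq R K (\<lambda>n. z (n - a)))"
      unfolding lambda_eps_eq_INF[OF R e U(2)] by (intro INF_lower) auto
    then show ?case by (simp add: rq_shift)
  qed
qed

lemma INF_rq_le_lambda_eps:
  fixes R :: "(int ^ 'd::finite) set"
  assumes R: "finite R" and e: "\<epsilon> > 0" and U: "bounded U"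
  shows "(INF z\<in>{z. finite {n. z n \<noteq> 0} \<and> (\<exists>n. z n \<noteq> 0)}. ereal (rq R K z)) \<le> lambda_eps R \<epsilon> K U"
  unfolding lambda_eps_eq_INF[OF assms]
  by (rule INF_superset_mono)
    (auto simp: dint_def intro: finite_subset[OF _ finite_rescaled[OF U e]])

lemma lambda_eps_tendsto_INF_rq:
  fixes R :: "(int ^ 'd::finite) set"
  assumes R: "finite R" and U: "open U" "bounded U" "U \<noteq> {}"
  shows "((\<lambda>\<epsilon>. lambda_eps R \<epsilon> K U) \<longlongrightarrow>
    (INF z\<in>{z. finite {n. z n \<noteq> 0} \<and> (\<exists>n. z n \<noteq> 0)}. ereal (rq R K z))) (at_right 0)"
    (is "(_ \<longlongrightarrow> ?m) _")
proof (rule order_tendstoI)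
  fix a assume a: "a < ?m"
  have "eventually (\<lambda>\<epsilon>::real. \<epsilon> > 0) (at_right 0)" by (rule eventually_at_right_less)
  then show "eventually (\<lambda>\<epsilon>. a < lambda_eps R \<epsilon> K U) (at_right 0)"
    by eventually_elim (use a INF_rq_le_lambda_eps[OF R _ U(2)] in \<open>blast intro: less_le_trans\<close>)
next
  fix a assume "?m < a"
  then obtain z where z: "finite {n. z n \<noteq> 0}" "\<exists>n. z n \<noteq> 0" "ereal (rq R K z) < a"
    by (auto simp: INF_less_iff)
  from eventually_lambda_eps_le[OF R U z(1,2), of K]
  show "eventually (\<lambda>\<epsilon>. lambda_eps R \<epsilon> K U < a) (at_right 0)"
    by eventually_elim (use z(3) in \<open>blast intro: le_less_trans\<close>)
qed

lemma lambda_atom_eq_INF_rq: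
  fixes R :: "(int ^ 'd::finite) set"
  assumes R: "finite R"
  shows "lambda_atom R K = (INF z\<in>{z. finite {n. z n \<noteq> 0} \<and> (\<exists>n. z n \<noteq> 0)}. ereal (rq R K z))"
  unfolding lambda_atom_def
proof (rule the_equality)
  fix l
  assume l: "\<forall>U. open U \<and> bounded U \<and> U \<noteq> {} \<longrightarrow> ((\<lambda>\<epsilon>. lambda_eps R \<epsilon> K U) \<longlongrightarrow> l) (at_right 0)"
  let ?U = "ball (0 :: real ^ 'd) 1"
  have U: "open ?U" "bounded ?U" "?U \<noteq> {}"
    by auto
  then have 1: "((\<lambda>\<epsilon>. lambda_eps R \<epsilon> K ?U) \<longlongrightarrow> l) (at_right 0)"
    using l by simp
  show "l = (INF z\<in>{z. finite {n. z n \<noteq> 0} \<and> (\<exists>n. z n \<noteq> 0)}. ereal (rq R K z))"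
    by (rule tendsto_unique[OF trivial_limit_at_right_real 1 lambda_eps_tendsto_INF_rq[OF R U]])
next
  show "\<forall>U. open U \<and> bounded U \<and> U \<noteq> {} \<longrightarrow> ((\<lambda>\<epsilon>. lambda_eps R \<epsilon> K U) \<longlongrightarrow>
      (INF z\<in>{z. finite {n. z n \<noteq> 0} \<and> (\<exists>n. z n \<noteq> 0)}. ereal (rq R K z))) (at_right 0)"
    by (intro allI impI lambda_eps_tendsto_INF_rq[OF R]) (elim conjE, assumption)+
qed

lemma lambda_atom_tendsto:
  fixes R :: "(int ^ 'd::finite) set"
  assumes "finite R" "open U" "bounded U" "U \<noteq> {}"
  shows "((\<lambda>\<epsilon>. lambda_eps R \<epsilon> K U) \<longlongrightarrow> lambda_atom R K) (at_right 0)"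
  using lambda_eps_tendsto_INF_rq[OF assms] lambda_atom_eq_INF_rq[OF assms(1)] by simp

lemma lambda_atom_eq_INF:
  fixes R :: "(int ^ 'd::finite) set"
  assumes R: "finite R" and U: "open U" "bounded U" "U \<noteq> {}"
  shows "lambda_atom R K = (INF \<epsilon>\<in>{0<..}. lambda_eps R \<epsilon> K U)"
proof (rule antisym)
  show "lambda_atom R K \<le> (INF \<epsilon>\<in>{0<..}. lambda_eps R \<epsilon> K U)"
    using INF_rq_le_lambda_eps[OF R _ U(2)] lambda_atom_eq_INF_rq[OF R]
    by (intro INF_greatest) simp
  have "eventually (\<lambda>\<epsilon>::real. \<epsilon> > 0) (at_right 0)" by (rule eventually_at_right_less)
  then have "eventually (\<lambda>\<epsilon>. (INF \<epsilon>\<in>{0<..}. lambda_eps R \<epsilon> K U) \<le> lambda_eps R \<epsilon> K U) (at_right 0)"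
    by eventually_elim (intro INF_lower, simp)
  then show "(INF \<epsilon>\<in>{0<..}. lambda_eps R \<epsilon> K U) \<le> lambda_atom R K"
    by (rule tendsto_lowerbound[OF lambda_atom_tendsto[OF assms]]) simp
qed

end

theory Submission
  imports Defs
begin

text \<open>
  Rescaled to the integer lattice by the factor \<open>\<epsilon>\<close>, the claim is a discrete Garding inequality for
  a finitely supported displacement \<open>z\<close> at the length scale \<open>s = r \<epsilon> / \<epsilon> \<ge> 1\<close>. It follows by
  localization and freezing of the coefficients. Let \<open>tent s\<close> be the radial tent function of radius
  \<open>s\<close>, and for every lattice point \<open>a\<close> multiply \<open>z\<close> by the translate \<open>tent s (n - a)\<close>.

  The differences of this product live within distance \<open>s + R_max R\<close> of \<open>a\<close>, so any two points that
  carry them are at most \<open>2 * s + 2 * R_max R\<close> apart. On this range the coefficients vary by at most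
  \<open>l / 4\<close>; comparing with the constant coefficient at one of these points, whose atomistic stability
  constant is at least \<open>l\<close>, leaves coercivity with constant \<open>3 / 4 * l\<close>
  (\<open>slowly_varying_coercive\<close>).

  By the discrete product rule, the difference stencil of the product is \<open>tent s (n - a)\<close> times that of
  \<open>z\<close>, plus an error in which the differences of the tent multiply the values of \<open>z\<close>. Young's
  inequality (\<open>bilin_cutoff_le\<close>) separates the two and lowers the constant from \<open>3 / 4 * l\<close> to
  \<open>l / 2\<close>.

  Now sum over all \<open>a\<close>. The squares of the translated tents have a sum that does not depend on the
  point (\<open>sum_tent_translates\<close>), so the main terms reassemble to the energy of \<open>z\<close> times
  \<open>tent_mass\<close>; the translates serve as a partition of unity without any covering of the domain. The
  errors contribute at most a constant times \<open>tent_mass\<close> over \<open>s\<^sup>2\<close> times the squared \<open>\<ell>\<^sup>2\<close> norm of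
  \<open>z\<close> (\<open>sum_tent_differences_le\<close>), because the tent is 1-Lipschitz but of height comparable to \<open>s\<close> on
  a fixed proportion of its support. Dividing by \<open>tent_mass\<close> gives \<open>lattice_garding\<close>.
\<close>

section \<open>Quadratic forms on difference stencils\<close>

lemma norm_R_sq: "(norm_R R M)\<^sup>2 = (\<Sum>\<rho>\<in>R. (norm (M \<rho>))\<^sup>2)"
  by (simp add: norm_R_def sum_nonneg)

lemma norm_R_nonneg: "norm_R R M \<ge> 0"
  by (simp add: norm_R_def sum_nonneg)

lemma norm_R_sq_components:
  "(norm_R R M)\<^sup>2 = (\<Sum>(i, \<rho>)\<in>UNIV \<times> R. (M \<rho> $ i)\<^sup>2)"
proof -
  have "(norm (M \<rho>))\<^sup>2 = (\<Sum>i\<in>UNIV. (M \<rho> $ i)\<^sup>2)" for \<rho>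
    by (simp add: norm_vec_def L2_set_def sum_nonneg)
  then show ?thesis
    unfolding norm_R_sq by (simp add: sum.cartesian_product[symmetric] sum.swap[of _ R])
qed

lemma abs_bilin_le:
  "\<bar>bilin R K M N\<bar> \<le> tensor_norm R K * norm_R R M * norm_R R N"
proof -
  let ?I = "UNIV \<times> R"
  let ?k = "\<lambda>((i, \<rho>), (j, \<sigma>)). K i \<rho> j \<sigma>"
  let ?m = "\<lambda>((i, \<rho>), (j, \<sigma>)). M \<rho> $ i * N \<sigma> $ j"
  have b: "bilin R K M N = (\<Sum>p\<in>?I \<times> ?I. ?k p * ?m p)"
    by (simp add: bilin_def sum.cartesian_product' mult.assoc)
  have k: "tensor_norm R K = L2_set ?k (?I \<times> ?I)"
    by (simp add: tensor_norm_def L2_set_def sum.cartesian_product')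
  have "(\<Sum>p\<in>?I \<times> ?I. (?m p)\<^sup>2) = (norm_R R M)\<^sup>2 * (norm_R R N)\<^sup>2"
    unfolding norm_R_sq_components sum_product
    by (simp add: sum.cartesian_product' power_mult_distrib)
  then have m: "norm_R R M * norm_R R N = L2_set ?m (?I \<times> ?I)"
    by (simp add: L2_set_def real_sqrt_mult norm_R_nonneg)
  have "\<bar>bilin R K M N\<bar> \<le> (\<Sum>p\<in>?I \<times> ?I. \<bar>?k p\<bar> * \<bar>?m p\<bar>)"
    unfolding b by (rule order_trans[OF sum_abs]) (simp add: abs_mult)
  also have "\<dots> \<le> L2_set ?k (?I \<times> ?I) * L2_set ?m (?I \<times> ?I)"
    by (rule L2_set_mult_ineq)
  finally show ?thesis by (simp add: k m[symmetric] mult.assoc)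
qed

lemma bilin_diff: "bilin R (K - K') M N = bilin R K M N - bilin R K' M N"
  by (simp add: bilin_def sum_subtractf[symmetric] algebra_simps)

lemma bilin_scale_add:
  "bilin R K (\<lambda>\<rho>. c *\<^sub>R M \<rho> + w \<rho>) (\<lambda>\<rho>. c *\<^sub>R M \<rho> + w \<rho>) =
    c\<^sup>2 * bilin R K M M + c * (bilin R K M w + bilin R K w M) + bilin R K w w"
  by (simp add: bilin_def sum_distrib_left sum.distrib[symmetric] algebra_simps power2_eq_square)

text \<open>The weight \<open>5 / 6\<close> is chosen so that \<open>3 / 4 * (5 / 6) = 1 / 2 + 1 / 8\<close>: the surplus \<open>1 / 8\<close>
  over the final constant pays for the cross terms in \<open>bilin_cutoff_le\<close>.\<close>

lemma norm_add_sq_ge: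
  fixes a b :: "'a::real_inner"
  shows "(norm (a + b))\<^sup>2 \<ge> 5 / 6 * (norm a)\<^sup>2 - 5 * (norm b)\<^sup>2"
proof -
  have "0 \<le> (norm (a + 6 *\<^sub>R b))\<^sup>2" by simp
  also have "\<dots> = (norm a)\<^sup>2 + 12 * (a \<bullet> b) + 36 * (norm b)\<^sup>2"
    by (simp add: power2_norm_eq_inner algebra_simps inner_commute)
  finally have "a \<bullet> b \<ge> - ((norm a)\<^sup>2 + 36 * (norm b)\<^sup>2) / 12" by simp
  moreover have "(norm (a + b))\<^sup>2 = (norm a)\<^sup>2 + 2 * (a \<bullet> b) + (norm b)\<^sup>2"
    by (simp add: power2_norm_eq_inner algebra_simps inner_commute)
  ultimately show ?thesis by simp
qed

lemma norm_R_scale_add_ge: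
  "(norm_R R (\<lambda>\<rho>. c *\<^sub>R M \<rho> + w \<rho>))\<^sup>2 \<ge> 5 / 6 * c\<^sup>2 * (norm_R R M)\<^sup>2 - 5 * (norm_R R w)\<^sup>2"
proof -
  have "5 / 6 * c\<^sup>2 * (norm_R R M)\<^sup>2 - 5 * (norm_R R w)\<^sup>2
      = (\<Sum>\<rho>\<in>R. 5 / 6 * (norm (c *\<^sub>R M \<rho>))\<^sup>2 - 5 * (norm (w \<rho>))\<^sup>2)"
    by (simp add: norm_R_sq sum_subtractf sum_distrib_left power_mult_distrib mult.assoc)
  also have "\<dots> \<le> (norm_R R (\<lambda>\<rho>. c *\<^sub>R M \<rho> + w \<rho>))\<^sup>2"
    unfolding norm_R_sq by (intro sum_mono norm_add_sq_ge)
  finally show ?thesis .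
qed

text \<open>Used with \<open>M\<close> the stencil of \<open>z\<close>, \<open>c\<close> the value of a cutoff, and \<open>w\<close> the commutator of cutoff
  and difference. The main term carries exactly the factor \<open>c\<^sup>2\<close>, so that summation over cutoffs whose
  squares add up to a constant restores a multiple of the energy of \<open>z\<close>. In the constant of the error,
  \<open>8 * \<Lambda>\<^sup>2 / l\<close> comes from the cross terms, \<open>\<Lambda>\<close> from the form at \<open>w\<close>, and \<open>15 / 4 * l\<close> from
  \<open>norm_add_sq_ge\<close>.\<close>

lemma bilin_cutoff_le:
  fixes M w :: "int ^ 'd::finite \<Rightarrow> real ^ 'd" and c :: real
  assumes K: "tensor_norm R K \<le> \<Lambda>" and l: "l > 0" and L: "\<Lambda> > 0"
  defines "M' \<equiv> \<lambda>\<rho>. c *\<^sub>R M \<rho> + w \<rho>"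
  shows "bilin R K M' M' - 3 / 4 * l * (norm_R R M')\<^sup>2
    \<le> c\<^sup>2 * (bilin R K M M - l / 2 * (norm_R R M)\<^sup>2) + (8 * \<Lambda>\<^sup>2 / l + \<Lambda> + 15 / 4 * l) * (norm_R R w)\<^sup>2"
proof -
  define m where "m = norm_R R M"
  define v where "v = norm_R R w"
  have nn: "m \<ge> 0" "v \<ge> 0" by (simp_all add: m_def v_def norm_R_nonneg)
  have bd: "\<bar>bilin R K X Y\<bar> \<le> \<Lambda> * (norm_R R X * norm_R R Y)" for X Y
  proof -
    have "tensor_norm R K * (norm_R R X * norm_R R Y) \<le> \<Lambda> * (norm_R R X * norm_R R Y)"
      by (intro mult_right_mono[OF K] mult_nonneg_nonneg norm_R_nonneg)
    then show ?thesis using abs_bilin_le[of R K X Y] by (simp add: mult.assoc)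
  qed
  have "\<bar>bilin R K M w + bilin R K w M\<bar> \<le> 2 * \<Lambda> * (m * v)"
    using bd[of M w] bd[of w M] by (simp add: m_def v_def mult.commute)
  then have "\<bar>c\<bar> * \<bar>bilin R K M w + bilin R K w M\<bar> \<le> \<bar>c\<bar> * (2 * \<Lambda> * (m * v))"
    by (rule mult_left_mono) simp
  then have x: "c * (bilin R K M w + bilin R K w M) \<le> 2 * (\<bar>c\<bar> * m) * (\<Lambda> * v)"
    using abs_ge_self[of "c * (bilin R K M w + bilin R K w M)"]
    by (simp add: abs_mult mult_ac)
  \<comment> \<open>Young's inequality, weighted so that the cross term costs only \<open>l / 8\<close> of the coercivity.\<close>
  have y: "2 * (\<bar>c\<bar> * m) * (\<Lambda> * v) \<le> l / 8 * (\<bar>c\<bar> * m)\<^sup>2 + 8 / l * (\<Lambda> * v)\<^sup>2"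
  proof -
    have "0 \<le> (l * (\<bar>c\<bar> * m) - 8 * (\<Lambda> * v))\<^sup>2 / (8 * l)" using l by simp
    also have "\<dots> = l / 8 * (\<bar>c\<bar> * m)\<^sup>2 + 8 / l * (\<Lambda> * v)\<^sup>2 - 2 * (\<bar>c\<bar> * m) * (\<Lambda> * v)"
      using l by (simp add: power2_eq_square field_simps)
    finally show ?thesis by simp
  qed
  have w: "bilin R K w w \<le> \<Lambda> * v\<^sup>2"
    using bd[of w w] by (simp add: v_def power2_eq_square)
  have n: "3 / 4 * l * (5 / 6 * c\<^sup>2 * m\<^sup>2 - 5 * v\<^sup>2) \<le> 3 / 4 * l * (norm_R R M')\<^sup>2"
    unfolding M'_def m_def v_def using l by (intro mult_left_mono norm_R_scale_add_ge) simp
  have "bilin R K M' M' - 3 / 4 * l * (norm_R R M')\<^sup>2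
    \<le> c\<^sup>2 * bilin R K M M + (l / 8 * (\<bar>c\<bar> * m)\<^sup>2 + 8 / l * (\<Lambda> * v)\<^sup>2) + \<Lambda> * v\<^sup>2
      - 3 / 4 * l * (5 / 6 * c\<^sup>2 * m\<^sup>2 - 5 * v\<^sup>2)"
    using x y w n unfolding M'_def bilin_scale_add by linarith
  also have "\<dots> = c\<^sup>2 * (bilin R K M M - l / 2 * m\<^sup>2) + (8 * \<Lambda>\<^sup>2 / l + \<Lambda> + 15 / 4 * l) * v\<^sup>2"
    by (simp add: power_mult_distrib algebra_simps)
  finally show ?thesis by (simp add: m_def v_def)
qed

section \<open>Coercivity for constant and for slowly varying coefficients\<close>

text \<open>The atomistic stability constant bounds every Rayleigh quotient from below. Positivity of \<open>l\<close>
  excludes a vanishing denominator, for which the quotient would be \<open>0\<close> by convention.\<close>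

lemma lambda_atom_coercive:
  fixes R :: "(int ^ 'd::finite) set"
  assumes R: "finite R" and l: "l > 0" "ereal l \<le> lambda_atom R K"
    and z: "finite {n. z n \<noteq> 0}"
    and S: "finite S" "\<And>n \<rho>. \<rho> \<in> R \<Longrightarrow> dz z n \<rho> \<noteq> 0 \<Longrightarrow> n \<in> S"
  shows "l * (\<Sum>n\<in>S. (norm_R R (dz z n))\<^sup>2) \<le> (\<Sum>n\<in>S. bilin R K (dz z n) (dz z n))"
proof (cases "\<exists>n. z n \<noteq> 0")
  case False
  then show ?thesis by (simp add: dz_def norm_R_def bilin_def)
next
  case True
  define N where "N = {n. \<exists>\<rho>\<in>R. dz z n \<rho> \<noteq> 0}"
  have NS: "N \<subseteq> S" using S(2) by (auto simp: N_def)
  have z0: "dz z n \<rho> = 0" if "n \<notin> N" "\<rho> \<in> R" for n \<rho>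
    using that by (auto simp: N_def)
  have b: "(\<Sum>n\<in>S. bilin R K (dz z n) (dz z n)) = (\<Sum>n\<in>N. bilin R K (dz z n) (dz z n))"
    using S(1) NS z0 by (intro sum.mono_neutral_right) (auto simp: bilin_def)
  have e: "(\<Sum>n\<in>S. (norm_R R (dz z n))\<^sup>2) = (\<Sum>n\<in>N. (norm_R R (dz z n))\<^sup>2)"
    using S(1) NS z0 by (intro sum.mono_neutral_right) (auto simp: norm_R_def)
  have "ereal l \<le> ereal (rq R K z)"
    using l(2) unfolding lambda_atom_eq_INF_rq[OF R]
    by (rule order_trans) (intro INF_lower, use z True in auto)
  then have q: "l \<le> (\<Sum>n\<in>S. bilin R K (dz z n) (dz z n)) / (\<Sum>n\<in>S. (norm_R R (dz z n))\<^sup>2)"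
    by (simp add: rq_def Let_def b e N_def)
  moreover have "(\<Sum>n\<in>S. (norm_R R (dz z n))\<^sup>2) \<ge> 0" by (simp add: sum_nonneg)
  moreover have "(\<Sum>n\<in>S. (norm_R R (dz z n))\<^sup>2) \<noteq> 0" using q l(1) by auto
  ultimately show ?thesis by (simp add: pos_le_divide_eq)
qed

text \<open>Freezing the coefficients at one point \<open>n0\<close> of the support of the differences of \<open>z\<close> changes the
  quadratic form by at most \<open>l / 4\<close> times the squared norm, and the frozen form is coercive with
  constant \<open>l\<close>.\<close>

lemma slowly_varying_coercive:
  fixes R :: "(int ^ 'd::finite) set" and B :: "int ^ 'd \<Rightarrow> 'd tensor"
  assumes R: "finite R" and l: "l > 0"
    and B: "\<And>n. n \<in> S \<Longrightarrow> ereal l \<le> lambda_atom R (B n)"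
    and z: "finite {n. z n \<noteq> 0}"
    and S: "finite S" "\<And>n \<rho>. \<rho> \<in> R \<Longrightarrow> dz z n \<rho> \<noteq> 0 \<Longrightarrow> n \<in> S"
    and osc: "\<And>n n' \<rho> \<rho>'. \<rho> \<in> R \<Longrightarrow> \<rho>' \<in> R \<Longrightarrow> dz z n \<rho> \<noteq> 0 \<Longrightarrow> dz z n' \<rho>' \<noteq> 0
      \<Longrightarrow> tensor_norm R (B n - B n') \<le> l / 4"
  shows "(\<Sum>n\<in>S. bilin R (B n) (dz z n) (dz z n) - 3 / 4 * l * (norm_R R (dz z n))\<^sup>2) \<ge> 0"
proof (cases "\<exists>n0. \<exists>\<rho>0\<in>R. dz z n0 \<rho>0 \<noteq> 0")
  case False
  then show ?thesis by (simp add: norm_R_def bilin_def)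
next
  case True
  then obtain n0 \<rho>0 where n0: "\<rho>0 \<in> R" "dz z n0 \<rho>0 \<noteq> 0" by blast
  have le: "bilin R (B n) (dz z n) (dz z n) - 3 / 4 * l * (norm_R R (dz z n))\<^sup>2
    \<ge> bilin R (B n0) (dz z n) (dz z n) - l * (norm_R R (dz z n))\<^sup>2" for n
  proof (cases "\<exists>\<rho>\<in>R. dz z n \<rho> \<noteq> 0")
    case False
    then show ?thesis by (simp add: norm_R_def bilin_def)
  next
    case True
    then have "tensor_norm R (B n - B n0) \<le> l / 4" using osc n0 by blast
    then have "tensor_norm R (B n - B n0) * (norm_R R (dz z n))\<^sup>2 \<le> l / 4 * (norm_R R (dz z n))\<^sup>2"
      by (rule mult_right_mono) simp
    then show ?thesis
      using abs_bilin_le[of R "B n - B n0" "dz z n" "dz z n"]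
      by (simp add: bilin_diff power2_eq_square mult.assoc)
  qed
  have "n0 \<in> S" using S(2) n0 by blast
  then have "0 \<le> (\<Sum>n\<in>S. bilin R (B n0) (dz z n) (dz z n) - l * (norm_R R (dz z n))\<^sup>2)"
    using lambda_atom_coercive[OF R l B z S] by (simp add: sum_subtractf sum_distrib_left)
  also have "\<dots> \<le> (\<Sum>n\<in>S. bilin R (B n) (dz z n) (dz z n) - 3 / 4 * l * (norm_R R (dz z n))\<^sup>2)"
    by (intro sum_mono le)
  finally show ?thesis .
qed

section \<open>Tent cutoffs on the integer lattice\<close>

lemma card_int_box:
  "card {m :: int ^ 'd::finite. \<forall>i. m $ i \<in> {- int k..int k}} = (2 * k + 1) ^ CARD('d)"
proof -
  have "bij_betw vec_lambda ((UNIV :: 'd set) \<rightarrow>\<^sub>E {- int k..int k})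
      {m :: int ^ 'd. \<forall>i. m $ i \<in> {- int k..int k}}"
    by (rule bij_betwI[where g = vec_nth]) (auto simp: PiE_def Pi_def)
  then have "card {m :: int ^ 'd. \<forall>i. m $ i \<in> {- int k..int k}}
      = card ((UNIV :: 'd set) \<rightarrow>\<^sub>E {- int k..int k})"
    by (simp add: bij_betw_same_card)
  also have "\<dots> = (2 * k + 1) ^ CARD('d)"
    by (simp add: card_PiE nat_add_distrib nat_mult_distrib)
  finally show ?thesis .
qed

lemma finite_int_box: "finite {m :: int ^ 'd::finite. \<forall>i. m $ i \<in> {- int k..int k}}"
  by (rule card_ge_0_finite) (simp add: card_int_box del: atLeastAtMost_iff)

lemma finite_lattice_ball: "finite {m :: int ^ 'd::finite. norm (real_vec m) < s}"
  using finite_rescaled[of "ball 0 s" 1] by (simp add: bounded_ball)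

text \<open>The two counting bounds compare balls with cubes. They are crude, but both are of order
  \<open>s ^ CARD('d)\<close>, so that a ball and the ball of half its radius have comparable cardinality.\<close>

lemma card_lattice_ball_le:
  assumes s: "s \<ge> 1"
  shows "real (card {m :: int ^ 'd::finite. norm (real_vec m) < s}) \<le> (3 * s) ^ CARD('d)"
proof -
  define k where "k = nat \<lfloor>s\<rfloor>"
  have "{m :: int ^ 'd. norm (real_vec m) < s} \<subseteq> {m. \<forall>i. m $ i \<in> {- int k..int k}}"
  proof safe
    fix m :: "int ^ 'd" and i assume m: "norm (real_vec m) < s"
    have "\<bar>real_vec m $ i\<bar> < s" using component_le_norm_cart m by (rule le_less_trans)
    then have "\<bar>m $ i\<bar> \<le> \<lfloor>s\<rfloor>" by (simp add: real_vec_def le_floor_iff)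
    then show "m $ i \<in> {- int k..int k}" using s by (simp add: k_def abs_le_iff)
  qed
  then have "card {m :: int ^ 'd. norm (real_vec m) < s} \<le> (2 * k + 1) ^ CARD('d)"
    unfolding card_int_box[symmetric] by (intro card_mono finite_int_box)
  then have "real (card {m :: int ^ 'd. norm (real_vec m) < s}) \<le> real (2 * k + 1) ^ CARD('d)"
    by (metis of_nat_le_iff of_nat_power)
  also have "\<dots> \<le> (3 * s) ^ CARD('d)"
  proof (rule power_mono)
    have "real k \<le> s" using s by (simp add: k_def)
    then show "real (2 * k + 1) \<le> 3 * s" using s by simp
  qed simp
  finally show ?thesis .
qed

lemma card_lattice_ball_ge:
  assumes s: "s \<ge> 0"
  shows "(s / real CARD('d)) ^ CARD('d) \<le> real (card {m :: int ^ 'd::finite. norm (real_vec m) \<le> s})"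
proof -
  define t where "t = s / real CARD('d)"
  define k where "k = nat \<lfloor>t\<rfloor>"
  have t: "t \<ge> 0" using s by (simp add: t_def)
  have kt: "real k \<le> t" using t by (simp add: k_def)
  have "{m :: int ^ 'd. \<forall>i. m $ i \<in> {- int k..int k}} \<subseteq> {m. norm (real_vec m) \<le> s}"
  proof safe
    fix m :: "int ^ 'd" assume m: "\<forall>i. m $ i \<in> {- int k..int k}"
    have "norm (real_vec m) \<le> (\<Sum>i\<in>UNIV. \<bar>real_vec m $ i\<bar>)" by (rule norm_le_l1_cart)
    also have "\<dots> \<le> (\<Sum>i\<in>(UNIV :: 'd set). t)"
    proof (rule sum_mono)
      fix i
      have "\<bar>m $ i\<bar> \<le> int k" using m by (simp add: abs_le_iff minus_le_iff)
      then have "\<bar>real_of_int (m $ i)\<bar> \<le> real k" by linarith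
      then show "\<bar>real_vec m $ i\<bar> \<le> t" using kt by (simp add: real_vec_def)
    qed
    also have "\<dots> = s" by (simp add: t_def)
    finally show "norm (real_vec m) \<le> s" .
  qed
  moreover have "finite {m :: int ^ 'd. norm (real_vec m) \<le> s}"
    by (rule finite_subset[OF _ finite_lattice_ball[of "s + 1"]]) auto
  ultimately have "(2 * k + 1) ^ CARD('d) \<le> card {m :: int ^ 'd. norm (real_vec m) \<le> s}"
    unfolding card_int_box[symmetric] by (intro card_mono)
  then have "real (2 * k + 1) ^ CARD('d) \<le> real (card {m :: int ^ 'd. norm (real_vec m) \<le> s})"
    by (metis of_nat_le_iff of_nat_power)
  moreover have "t ^ CARD('d) \<le> real (2 * k + 1) ^ CARD('d)"
  proof (rule power_mono[OF _ t])
    show "t \<le> real (2 * k + 1)" using t unfolding k_def by linarith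
  qed
  ultimately show ?thesis by (simp add: t_def)
qed

definition tent :: "real \<Rightarrow> int ^ 'd::finite \<Rightarrow> real" where
  "tent s m = max 0 (s - norm (real_vec m))"

lemma tent_nonzero_iff: "tent s m \<noteq> 0 \<longleftrightarrow> norm (real_vec m) < s"
  by (auto simp: tent_def)

lemma tent_lipschitz: "\<bar>tent s (m + \<rho>) - tent s m\<bar> \<le> norm (real_vec \<rho>)"
  using norm_triangle_ineq[of "real_vec m" "real_vec \<rho>"]
    norm_triangle_ineq4[of "real_vec m + real_vec \<rho>" "real_vec \<rho>"]
  unfolding tent_def by (simp add: max_def) linarith

definition tent_mass :: "real \<Rightarrow> 'd::finite itself \<Rightarrow> real" where
  "tent_mass s _ = (\<Sum>m | norm (real_vec (m :: int ^ 'd)) < s. (tent s m)\<^sup>2)"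

text \<open>The tent is at least \<open>s / 2\<close> on the ball of radius \<open>s / 2\<close>, which contains a fixed proportion of
  the lattice points of the ball of radius \<open>s\<close>. The assumption \<open>s \<ge> 1\<close> keeps the cardinality of
  the large ball below a multiple of \<open>s ^ CARD('d)\<close>.\<close>

lemma tent_mass_ge:
  assumes s: "s \<ge> 1"
  shows "s\<^sup>2 * real (card {m :: int ^ 'd::finite. norm (real_vec m) < s})
    \<le> 4 * (6 * real CARD('d)) ^ CARD('d) * tent_mass s TYPE('d)"
proof -
  let ?H = "{m :: int ^ 'd. norm (real_vec m) \<le> s / 2}"
  let ?G = "(6 * real CARD('d)) ^ CARD('d)"
  have "real (card {m :: int ^ 'd. norm (real_vec m) < s}) \<le> (3 * s) ^ CARD('d)"
    by (rule card_lattice_ball_le[OF s])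
  also have "\<dots> = ?G * (s / 2 / real CARD('d)) ^ CARD('d)"
    by (subst power_mult_distrib[symmetric]) simp
  also have "\<dots> \<le> ?G * real (card ?H)"
    using s by (intro mult_left_mono card_lattice_ball_ge) auto
  finally have c: "real (card {m :: int ^ 'd. norm (real_vec m) < s}) \<le> ?G * real (card ?H)" .
  have "(s / 2)\<^sup>2 * real (card ?H) = (\<Sum>m\<in>?H. (s / 2)\<^sup>2)" by simp
  also have "\<dots> \<le> (\<Sum>m\<in>?H. (tent s m)\<^sup>2)"
    using s by (intro sum_mono power_mono) (auto simp: tent_def)
  also have "\<dots> \<le> tent_mass s TYPE('d)"
    unfolding tent_mass_def using s by (intro sum_mono2 finite_lattice_ball) auto
  finally have h: "s\<^sup>2 * real (card ?H) \<le> 4 * tent_mass s TYPE('d)"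
    by (simp add: power_divide)
  have "s\<^sup>2 * real (card {m :: int ^ 'd. norm (real_vec m) < s}) \<le> s\<^sup>2 * (?G * real (card ?H))"
    by (rule mult_left_mono[OF c]) simp
  also have "\<dots> = ?G * (s\<^sup>2 * real (card ?H))" by simp
  also have "\<dots> \<le> ?G * (4 * tent_mass s TYPE('d))"
    by (rule mult_left_mono[OF h]) simp
  finally show ?thesis by (simp add: mult_ac)
qed

lemma tent_mass_pos:
  assumes s: "s \<ge> 1"
  shows "tent_mass s TYPE('d::finite) > 0"
proof -
  have "0 < (tent s (0 :: int ^ 'd))\<^sup>2" using s by (simp add: tent_def real_vec_def zero_vec_def[symmetric])
  also have "\<dots> \<le> tent_mass s TYPE('d)"
    unfolding tent_mass_def using s
    by (intro member_le_sum finite_lattice_ball) (auto simp: real_vec_def zero_vec_def[symmetric])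
  finally show ?thesis .
qed

text \<open>The index set \<open>F\<close> only has to contain the centres whose tent reaches \<open>n\<close>; this allows a single
  finite \<open>F\<close> to serve for all points of a finite set.\<close>

lemma sum_tent_translates:
  fixes n :: "int ^ 'd::finite"
  assumes "finite F" "\<And>m. norm (real_vec m) < s \<Longrightarrow> n - m \<in> F"
  shows "(\<Sum>a\<in>F. (tent s (n - a))\<^sup>2) = tent_mass s TYPE('d)"
proof -
  have "(\<Sum>a\<in>F. (tent s (n - a))\<^sup>2) = (\<Sum>a | norm (real_vec (n - a)) < s. (tent s (n - a))\<^sup>2)"
  proof (rule sum.mono_neutral_right[OF assms(1)])
    show "{a. norm (real_vec (n - a)) < s} \<subseteq> F"
    proof safe
      fix a assume "norm (real_vec (n - a)) < s"
      from assms(2)[OF this] show "a \<in> F" by simp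
    qed
    show "\<forall>a\<in>F - {a. norm (real_vec (n - a)) < s}. (tent s (n - a))\<^sup>2 = 0"
    proof
      fix a assume "a \<in> F - {a. norm (real_vec (n - a)) < s}"
      then have "\<not> norm (real_vec (n - a)) < s" by simp
      then show "(tent s (n - a))\<^sup>2 = 0" unfolding tent_nonzero_iff[symmetric] by simp
    qed
  qed
  also have "\<dots> = tent_mass s TYPE('d)"
    unfolding tent_mass_def by (rule sum.reindex_bij_witness[of _ "\<lambda>m. n - m" "\<lambda>a. n - a"]) auto
  finally show ?thesis .
qed

text \<open>Each summand is at most \<open>(norm (real_vec \<rho>))\<^sup>2\<close> by the Lipschitz bound, and only the centres within
  \<open>s\<close> of \<open>n\<close> or of \<open>n + \<rho>\<close> contribute. Their number is controlled by \<open>tent_mass\<close>, which is where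
  the factor \<open>1 / s\<^sup>2\<close> is gained.\<close>

lemma sum_tent_differences_le:
  fixes n \<rho> :: "int ^ 'd::finite"
  assumes F: "finite F" and s: "s \<ge> 1"
  shows "(\<Sum>a\<in>F. (tent s (n + \<rho> - a) - tent s (n - a))\<^sup>2)
    \<le> 8 * (6 * real CARD('d)) ^ CARD('d) * (norm (real_vec \<rho>))\<^sup>2 / s\<^sup>2 * tent_mass s TYPE('d)"
proof -
  let ?B = "{m :: int ^ 'd. norm (real_vec m) < s}"
  let ?E = "(\<lambda>m. n - m) ` ?B \<union> (\<lambda>m. n + \<rho> - m) ` ?B"
  have finE: "finite ?E" by (intro finite_UnI finite_imageI finite_lattice_ball)
  have cE: "card ?E \<le> 2 * card ?B"
    using card_Un_le[of "(\<lambda>m. n - m) ` ?B" "(\<lambda>m. n + \<rho> - m) ` ?B"]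
      card_image_le[OF finite_lattice_ball[of s], of "\<lambda>m. n - m"]
      card_image_le[OF finite_lattice_ball[of s], of "\<lambda>m. n + \<rho> - m"] by linarith
  have "(\<Sum>a\<in>F. (tent s (n + \<rho> - a) - tent s (n - a))\<^sup>2)
      = (\<Sum>a\<in>F \<inter> ?E. (tent s (n + \<rho> - a) - tent s (n - a))\<^sup>2)"
  proof (rule sum.mono_neutral_right[OF F])
    show "\<forall>a\<in>F - F \<inter> ?E. (tent s (n + \<rho> - a) - tent s (n - a))\<^sup>2 = 0"
    proof
      fix a assume "a \<in> F - F \<inter> ?E"
      then have a: "a \<notin> (\<lambda>m. n - m) ` ?B" "a \<notin> (\<lambda>m. n + \<rho> - m) ` ?B" by auto
      have "n - a \<notin> ?B"
      proof
        assume "n - a \<in> ?B"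
        then have "n - (n - a) \<in> (\<lambda>m. n - m) ` ?B" by (rule imageI)
        then show False using a(1) by simp
      qed
      moreover have "n + \<rho> - a \<notin> ?B"
      proof
        assume "n + \<rho> - a \<in> ?B"
        then have "n + \<rho> - (n + \<rho> - a) \<in> (\<lambda>m. n + \<rho> - m) ` ?B" by (rule imageI)
        then show False using a(2) by simp
      qed
      ultimately have "tent s (n - a) = 0" "tent s (n + \<rho> - a) = 0"
        using tent_nonzero_iff by blast+
      then show "(tent s (n + \<rho> - a) - tent s (n - a))\<^sup>2 = 0"
        by (simp only: diff_self zero_power2)
    qed
  qed simp
  also have "\<dots> \<le> (\<Sum>a\<in>F \<inter> ?E. (norm (real_vec \<rho>))\<^sup>2)"
  proof (rule sum_mono)
    fix a
    have "\<bar>tent s (n + \<rho> - a) - tent s (n - a)\<bar> \<le> norm (real_vec \<rho>)"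
      using tent_lipschitz[of s "n - a" \<rho>] by (simp add: algebra_simps)
    then show "(tent s (n + \<rho> - a) - tent s (n - a))\<^sup>2 \<le> (norm (real_vec \<rho>))\<^sup>2"
      using power_mono[of "\<bar>_\<bar>" _ 2] by fastforce
  qed
  also have "\<dots> = real (card (F \<inter> ?E)) * (norm (real_vec \<rho>))\<^sup>2" by simp
  also have "\<dots> \<le> real (2 * card ?B) * (norm (real_vec \<rho>))\<^sup>2"
    by (intro mult_right_mono of_nat_mono order_trans[OF card_mono[OF finE] cE]) auto
  also have "\<dots> = 2 * (norm (real_vec \<rho>))\<^sup>2 / s\<^sup>2 * (s\<^sup>2 * real (card ?B))"
    using s by simp
  also have "\<dots> \<le> 2 * (norm (real_vec \<rho>))\<^sup>2 / s\<^sup>2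
      * (4 * (6 * real CARD('d)) ^ CARD('d) * tent_mass s TYPE('d))"
    by (intro mult_left_mono tent_mass_ge s) simp
  finally show ?thesis by (simp add: mult_ac)
qed

section \<open>The Garding inequality on the integer lattice\<close>

definition localization_const :: "(int ^ 'd::finite) set \<Rightarrow> real" where
  "localization_const R = 8 * (6 * real CARD('d)) ^ CARD('d) * (\<Sum>\<rho>\<in>R. (norm (real_vec \<rho>))\<^sup>2)"

text \<open>The inner function is the commutator of the cutoff centred at \<open>a\<close> with the difference stencil,
  applied to \<open>z\<close>. Summing over \<open>a\<close> first leaves, for each step in \<open>R\<close>, a translate of
  \<open>(norm (z n))\<^sup>2\<close>.\<close>

lemma localization_error_le:
  fixes R :: "(int ^ 'd::finite) set" and z :: "int ^ 'd \<Rightarrow> real ^ 'd"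
  assumes F: "finite F" and s: "s \<ge> 1" and S: "finite S" and z: "finite {n. z n \<noteq> 0}"
  shows "(\<Sum>a\<in>F. \<Sum>n\<in>S. (norm_R R (\<lambda>\<rho>. (tent s (n + \<rho> - a) - tent s (n - a)) *\<^sub>R z (n + \<rho>)))\<^sup>2)
    \<le> localization_const R / s\<^sup>2 * tent_mass s TYPE('d) * (\<Sum>n | z n \<noteq> 0. (norm (z n))\<^sup>2)"
proof -
  define c where "c = 8 * (6 * real CARD('d)) ^ CARD('d) / s\<^sup>2 * tent_mass s TYPE('d)"
  define Z where "Z = (\<Sum>n | z n \<noteq> 0. (norm (z n))\<^sup>2)"
  have c: "c \<ge> 0" using tent_mass_pos[OF s, where 'd = 'd] by (simp add: c_def)
  have shift: "(\<Sum>n\<in>S. (norm (z (n + \<rho>)))\<^sup>2) \<le> Z" for \<rho>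
  proof -
    have "(\<Sum>n\<in>S. (norm (z (n + \<rho>)))\<^sup>2) = (\<Sum>n\<in>(\<lambda>n. n + \<rho>) ` S. (norm (z n))\<^sup>2)"
      by (simp add: sum.reindex)
    also have "\<dots> = (\<Sum>n\<in>(\<lambda>n. n + \<rho>) ` S \<inter> {n. z n \<noteq> 0}. (norm (z n))\<^sup>2)"
      by (rule sum.mono_neutral_right) (use S in auto)
    also have "\<dots> \<le> Z" unfolding Z_def by (rule sum_mono2) (use z in auto)
    finally show ?thesis .
  qed
  have "(\<Sum>a\<in>F. \<Sum>n\<in>S. (norm_R R (\<lambda>\<rho>. (tent s (n + \<rho> - a) - tent s (n - a)) *\<^sub>R z (n + \<rho>)))\<^sup>2)
    = (\<Sum>a\<in>F. \<Sum>n\<in>S. \<Sum>\<rho>\<in>R. (tent s (n + \<rho> - a) - tent s (n - a))\<^sup>2 * (norm (z (n + \<rho>)))\<^sup>2)"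
    by (simp add: norm_R_sq power_mult_distrib)
  also have "\<dots> = (\<Sum>\<rho>\<in>R. \<Sum>n\<in>S. (norm (z (n + \<rho>)))\<^sup>2 *
      (\<Sum>a\<in>F. (tent s (n + \<rho> - a) - tent s (n - a))\<^sup>2))"
  proof -
    have "(\<Sum>a\<in>F. \<Sum>n\<in>S. \<Sum>\<rho>\<in>R. f a n \<rho>) = (\<Sum>\<rho>\<in>R. \<Sum>n\<in>S. \<Sum>a\<in>F. f a n \<rho>)" for f :: "_ \<Rightarrow> _ \<Rightarrow> _ \<Rightarrow> real"
    proof -
      have "(\<Sum>a\<in>F. \<Sum>n\<in>S. \<Sum>\<rho>\<in>R. f a n \<rho>) = (\<Sum>n\<in>S. \<Sum>a\<in>F. \<Sum>\<rho>\<in>R. f a n \<rho>)" by (rule sum.swap)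
      also have "\<dots> = (\<Sum>n\<in>S. \<Sum>\<rho>\<in>R. \<Sum>a\<in>F. f a n \<rho>)" by (intro sum.cong refl sum.swap)
      also have "\<dots> = (\<Sum>\<rho>\<in>R. \<Sum>n\<in>S. \<Sum>a\<in>F. f a n \<rho>)" by (rule sum.swap)
      finally show ?thesis .
    qed
    then show ?thesis by (simp add: sum_distrib_left mult.commute)
  qed
  also have "\<dots> \<le> (\<Sum>\<rho>\<in>R. \<Sum>n\<in>S. (norm (z (n + \<rho>)))\<^sup>2 * (c * (norm (real_vec \<rho>))\<^sup>2))"
    using sum_tent_differences_le[OF F s]
    by (intro sum_mono mult_left_mono) (simp_all add: c_def mult_ac)
  also have "\<dots> = (\<Sum>\<rho>\<in>R. c * (norm (real_vec \<rho>))\<^sup>2 * (\<Sum>n\<in>S. (norm (z (n + \<rho>)))\<^sup>2))"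
    by (simp add: sum_distrib_left mult_ac)
  also have "\<dots> \<le> (\<Sum>\<rho>\<in>R. c * (norm (real_vec \<rho>))\<^sup>2 * Z)"
    using c by (intro sum_mono mult_left_mono shift) auto
  also have "\<dots> = localization_const R / s\<^sup>2 * tent_mass s TYPE('d) * Z"
    by (simp add: localization_const_def c_def sum_distrib_left sum_distrib_right mult_ac
        sum_divide_distrib)
  finally show ?thesis by (simp add: Z_def)
qed

text \<open>The set \<open>S\<close> stands for the rescaled \<open>sint R \<epsilon> \<Omega>\<close>. The support conditions on \<open>z\<close> say that all
  its nonzero differences occur in \<open>S\<close>, where the coefficients are controlled, and they pass on to
  every product of \<open>z\<close> with a cutoff.\<close>

lemma lattice_garding:
  fixes R :: "(int ^ 'd::finite) set" and B :: "int ^ 'd \<Rightarrow> 'd tensor"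
  assumes R: "finite R" and l: "l > 0" and L: "\<Lambda> > 0" and s: "s \<ge> 1"
    and S: "finite S" and z: "finite {n. z n \<noteq> 0}"
    and zS: "\<And>n. z n \<noteq> 0 \<Longrightarrow> n \<in> S" "\<And>n \<rho>. \<rho> \<in> R \<Longrightarrow> z (n + \<rho>) \<noteq> 0 \<Longrightarrow> n \<in> S"
    and stab: "\<And>n. n \<in> S \<Longrightarrow> ereal l \<le> lambda_atom R (B n)"
    and bd: "\<And>n. n \<in> S \<Longrightarrow> tensor_norm R (B n) \<le> \<Lambda>"
    and osc: "\<And>n n'. n \<in> S \<Longrightarrow> n' \<in> S \<Longrightarrow> norm (real_vec n - real_vec n') \<le> 2 * s + 2 * R_max R
      \<Longrightarrow> tensor_norm R (B n - B n') \<le> l / 4"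
  shows "(\<Sum>n\<in>S. bilin R (B n) (dz z n) (dz z n))
    \<ge> l / 2 * (\<Sum>n\<in>S. (norm_R R (dz z n))\<^sup>2)
      - (8 * \<Lambda>\<^sup>2 / l + \<Lambda> + 15 / 4 * l) * localization_const R / s\<^sup>2 * (\<Sum>n | z n \<noteq> 0. (norm (z n))\<^sup>2)"
proof -
  define C where "C = 8 * \<Lambda>\<^sup>2 / l + \<Lambda> + 15 / 4 * l"
  define P where "P = tent_mass s TYPE('d)"
  define Z where "Z = (\<Sum>n | z n \<noteq> 0. (norm (z n))\<^sup>2)"
  define E where "E n = bilin R (B n) (dz z n) (dz z n) - l / 2 * (norm_R R (dz z n))\<^sup>2" for n
  define W where "W a n = (\<lambda>\<rho>. (tent s (n + \<rho> - a) - tent s (n - a)) *\<^sub>R z (n + \<rho>))" for a n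
  define za where "za a n = tent s (n - a) *\<^sub>R z n" for a n
  define F where "F = (\<lambda>(n, m). n - m) ` (S \<times> {m. norm (real_vec m) < s})"
  have C: "C > 0" using l L by (simp add: C_def add_pos_pos)
  have P: "P > 0" unfolding P_def by (rule tent_mass_pos[OF s])
  have F: "finite F" unfolding F_def using S finite_lattice_ball by (intro finite_imageI) auto
  have "0 \<le> (\<Sum>n\<in>S. (tent s (n - a))\<^sup>2 * E n + C * (norm_R R (W a n))\<^sup>2)" for a
  proof -
    \<comment> \<open>Discrete product rule with the value of \<open>z\<close> taken at \<open>n + \<rho>\<close>, so that the cutoff in front of
      \<open>dz z n\<close> is evaluated at \<open>n\<close> for all \<open>\<rho>\<close> and factors out of the quadratic form.\<close>
    have dza: "dz (za a) n = (\<lambda>\<rho>. tent s (n - a) *\<^sub>R dz z n \<rho> + W a n \<rho>)" for n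
      by (simp add: dz_def za_def W_def fun_eq_iff algebra_simps)
    have supp: "n \<in> S \<and> norm (real_vec n - real_vec a) \<le> s + R_max R"
      if r: "\<rho> \<in> R" "dz (za a) n \<rho> \<noteq> 0" for n \<rho>
    proof -
      have rm: "norm (real_vec \<rho>) \<le> R_max R" by (rule R_max_ge[OF R r(1)])
      then have rm0: "0 \<le> R_max R" by (rule order_trans[OF norm_ge_zero])
      from r(2) consider "za a n \<noteq> 0" | "za a (n + \<rho>) \<noteq> 0"
        by (metis dz_def diff_self)
      then show ?thesis
      proof cases
        case 1
        then have "z n \<noteq> 0" "tent s (n - a) \<noteq> 0" by (auto simp: za_def)
        then show ?thesis using zS(1) rm0 by (auto simp: tent_nonzero_iff)
      next
        case 2
        then have "z (n + \<rho>) \<noteq> 0" "tent s (n + \<rho> - a) \<noteq> 0" by (auto simp: za_def)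
        moreover have "norm (real_vec n - real_vec a)
            \<le> norm (real_vec (n + \<rho> - a)) + norm (real_vec \<rho>)"
          using norm_triangle_ineq4[of "real_vec (n + \<rho> - a)" "real_vec \<rho>"] by simp
        ultimately show ?thesis using zS(2)[OF r(1)] rm by (auto simp: tent_nonzero_iff)
      qed
    qed
    have "0 \<le> (\<Sum>n\<in>S. bilin R (B n) (dz (za a) n) (dz (za a) n)
        - 3 / 4 * l * (norm_R R (dz (za a) n))\<^sup>2)"
    proof (rule slowly_varying_coercive[OF R l stab _ S])
      show "finite {n. za a n \<noteq> 0}"
        by (rule finite_subset[OF _ z]) (auto simp: za_def)
      show "n \<in> S" if "\<rho> \<in> R" "dz (za a) n \<rho> \<noteq> 0" for n \<rho>
        using supp[OF that] by simp
      show "tensor_norm R (B n - B n') \<le> l / 4"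
        if "\<rho> \<in> R" "\<rho>' \<in> R" "dz (za a) n \<rho> \<noteq> 0" "dz (za a) n' \<rho>' \<noteq> 0" for n n' \<rho> \<rho>'
      proof (rule osc)
        show "norm (real_vec n - real_vec n') \<le> 2 * s + 2 * R_max R"
          using norm_triangle_ineq4[of "real_vec n - real_vec a" "real_vec n' - real_vec a"]
            supp[OF that(1,3)] supp[OF that(2,4)] by simp
      qed (use supp[OF that(1,3)] supp[OF that(2,4)] in auto)
    qed
    also have "\<dots> \<le> (\<Sum>n\<in>S. (tent s (n - a))\<^sup>2 * E n + C * (norm_R R (W a n))\<^sup>2)"
      unfolding dza E_def C_def by (intro sum_mono bilin_cutoff_le bd l L)
    finally show ?thesis .
  qed
  then have "0 \<le> (\<Sum>a\<in>F. \<Sum>n\<in>S. (tent s (n - a))\<^sup>2 * E n + C * (norm_R R (W a n))\<^sup>2)"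
    by (rule sum_nonneg)
  also have "\<dots> = (\<Sum>a\<in>F. \<Sum>n\<in>S. (tent s (n - a))\<^sup>2 * E n) + C * (\<Sum>a\<in>F. \<Sum>n\<in>S. (norm_R R (W a n))\<^sup>2)"
    by (simp add: sum.distrib sum_distrib_left)
  also have "(\<Sum>a\<in>F. \<Sum>n\<in>S. (tent s (n - a))\<^sup>2 * E n) = (\<Sum>n\<in>S. (\<Sum>a\<in>F. (tent s (n - a))\<^sup>2) * E n)"
    by (subst sum.swap) (simp add: sum_distrib_right)
  also have "\<dots> = (\<Sum>n\<in>S. P * E n)"
  proof (rule sum.cong[OF refl])
    fix n assume "n \<in> S"
    then have "(\<Sum>a\<in>F. (tent s (n - a))\<^sup>2) = P"
      unfolding P_def by (intro sum_tent_translates F) (auto simp: F_def)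
    then show "(\<Sum>a\<in>F. (tent s (n - a))\<^sup>2) * E n = P * E n" by simp
  qed
  also have "\<dots> = P * (\<Sum>n\<in>S. E n)" by (simp add: sum_distrib_left)
  also have "C * (\<Sum>a\<in>F. \<Sum>n\<in>S. (norm_R R (W a n))\<^sup>2) \<le> C * (localization_const R / s\<^sup>2 * P * Z)"
    unfolding W_def P_def Z_def using C
    by (intro mult_left_mono localization_error_le F s S z) simp
  finally have "0 \<le> P * ((\<Sum>n\<in>S. E n) + C * localization_const R / s\<^sup>2 * Z)"
    by (simp add: algebra_simps)
  then have "0 \<le> (\<Sum>n\<in>S. E n) + C * localization_const R / s\<^sup>2 * Z"
    using P by (simp add: zero_le_mult_iff)
  then show ?thesis
    unfolding E_def sum_subtractf C_def Z_def by (simp add: sum_distrib_left)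
qed

section \<open>The Garding inequality on a domain\<close>

theorem theorem5p2:
  fixes R :: "(int ^ 'd::finite) set" and lam1 \<Lambda> :: real
  assumes "finite R" "0 \<notin> R" "int_vec.span R = UNIV" "uminus ` R = R"
    and "lam1 > 0" "\<Lambda> > 0"
  shows "\<exists>lam2::real.
    \<forall>(\<Omega> :: (real ^ 'd) set) (eps0::real) (A :: real \<Rightarrow> real ^ 'd \<Rightarrow> 'd tensor) (r :: real \<Rightarrow> real).
      open \<Omega> \<and> bounded \<Omega> \<and> eps0 > 0 \<and>
      (\<forall>\<epsilon>\<in>{0<..eps0}. \<forall>x\<in>sint R \<epsilon> \<Omega>. lambda_atom R (A \<epsilon> x) \<ge> ereal lam1) \<and>
      (\<forall>\<epsilon>\<in>{0<..eps0}. \<forall>x\<in>sint R \<epsilon> \<Omega>. tensor_norm R (A \<epsilon> x) \<le> \<Lambda>) \<and>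
      (\<forall>\<epsilon>\<in>{0<..eps0}. r \<epsilon> \<ge> \<epsilon>) \<and>
      (\<forall>\<epsilon>\<in>{0<..eps0}. \<forall>x\<in>sint R \<epsilon> \<Omega>. \<forall>x'\<in>sint R \<epsilon> \<Omega>.
         norm (x - x') \<le> 2 * r \<epsilon> + 2 * \<epsilon> * R_max R \<longrightarrow>
         tensor_norm R (A \<epsilon> x - A \<epsilon> x') \<le> lam1 / 4)
      \<longrightarrow>
      (\<forall>\<epsilon>\<in>{0<..eps0}. \<forall>u\<in>A0 R \<epsilon> \<Omega>.
         \<epsilon> ^ CARD('d) * (\<Sum>x\<in>sint R \<epsilon> \<Omega>. bilin R (A \<epsilon> x) (D \<epsilon> u x) (D \<epsilon> u x))
           \<ge> lam1 / 2 * (h1_norm R \<epsilon> \<Omega> u)\<^sup>2 - lam2 / (r \<epsilon>)\<^sup>2 * (l2_norm R \<epsilon> \<Omega> u)\<^sup>2)"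
proof -
  define lam2 where
    "lam2 = (8 * \<Lambda>\<^sup>2 / lam1 + \<Lambda> + 15 / 4 * lam1) * localization_const R"
  show ?thesis
  proof (rule exI[of _ lam2], intro allI impI ballI, elim conjE)
    fix \<Omega> :: "(real ^ 'd) set" and eps0 \<epsilon> :: real and A :: "real \<Rightarrow> real ^ 'd \<Rightarrow> 'd tensor"
      and r :: "real \<Rightarrow> real" and u
    assume \<Omega>: "open \<Omega>" "bounded \<Omega>" and eps: "\<epsilon> \<in> {0<..eps0}" and u: "u \<in> A0 R \<epsilon> \<Omega>"
      and stab: "\<forall>\<epsilon>\<in>{0<..eps0}. \<forall>x\<in>sint R \<epsilon> \<Omega>. lambda_atom R (A \<epsilon> x) \<ge> ereal lam1"
      and bd: "\<forall>\<epsilon>\<in>{0<..eps0}. \<forall>x\<in>sint R \<epsilon> \<Omega>. tensor_norm R (A \<epsilon> x) \<le> \<Lambda>"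
      and rad: "\<forall>\<epsilon>\<in>{0<..eps0}. r \<epsilon> \<ge> \<epsilon>"
      and osc: "\<forall>\<epsilon>\<in>{0<..eps0}. \<forall>x\<in>sint R \<epsilon> \<Omega>. \<forall>x'\<in>sint R \<epsilon> \<Omega>.
         norm (x - x') \<le> 2 * r \<epsilon> + 2 * \<epsilon> * R_max R \<longrightarrow>
         tensor_norm R (A \<epsilon> x - A \<epsilon> x') \<le> lam1 / 4"
    let ?e = "\<lambda>n :: int ^ 'd. \<epsilon> *\<^sub>R real_vec n"
    have e: "\<epsilon> > 0" using eps by simp
    define s where "s = r \<epsilon> / \<epsilon>"
    have s: "s \<ge> 1" using rad eps e by (simp add: s_def)
    have r: "r \<epsilon> = \<epsilon> * s" using e by (simp add: s_def)
    define S where "S = {n. ?e n \<in> sint R \<epsilon> \<Omega>}"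
    define T where "T = {n. ?e n \<in> dint R \<epsilon> \<Omega>}"
    \<comment> \<open>Extension by zero discards the arbitrary values of \<open>u\<close> off \<open>\<Omega>\<close>; the differences over \<open>S\<close>
      do not see them.\<close>
    define z where "z n = (if ?e n \<in> \<Omega> then u (?e n) else 0)" for n
    have imS: "sint R \<epsilon> \<Omega> = ?e ` S" by (auto simp: S_def sint_def lattice_def)
    have imT: "dint R \<epsilon> \<Omega> = ?e ` T" by (auto simp: T_def dint_def lattice_def)
    have inj: "inj_on ?e X" for X using e by (auto simp: inj_on_def)
    have finS: "finite S"
      by (rule finite_subset[OF _ finite_rescaled[OF \<Omega>(2) e]]) (auto simp: S_def sint_def)
    have finT: "finite T"
      by (rule finite_subset[OF _ finite_rescaled[OF \<Omega>(2) e]]) (auto simp: T_def dint_def)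
    have supp: "?e n \<in> dint R \<epsilon> \<Omega>" if "z n \<noteq> 0" for n
      using that u by (auto simp: z_def A0_def dbdry_def lattice_def split: if_splits)
    then have zT: "{n. z n \<noteq> 0} \<subseteq> T" by (auto simp: T_def)
    have zS: "n \<in> S" if "z n \<noteq> 0" for n
      using supp[OF that] dint_sub_sint[OF e] by (auto simp: S_def)
    have zS': "n \<in> S" if "\<rho> \<in> R" "z (n + \<rho>) \<noteq> 0" for n \<rho>
      using dint_step_sint[OF assms(1) that(1) e supp[OF that(2)]] by (simp add: S_def)
    have Du: "D \<epsilon> u (?e n) \<rho> = inverse \<epsilon> *\<^sub>R dz z n \<rho>" if "n \<in> S" "\<rho> \<in> R" for n \<rho>
    proof -
      have "?e (n + \<rho>) \<in> \<Omega>" "?e n \<in> \<Omega>"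
        using sint_step_in[OF assms(1) that(2) e, of n \<Omega>] that(1) by (auto simp: S_def sint_def)
      then show ?thesis
        by (simp add: D_def dz_def z_def scaleR_right_distrib)
    qed
    have bil: "bilin R K (D \<epsilon> u (?e n)) (D \<epsilon> u (?e n)) = (inverse \<epsilon>)\<^sup>2 * bilin R K (dz z n) (dz z n)"
      if "n \<in> S" for n K
      unfolding bilin_scale[symmetric] using Du[OF that] by (rule bilin_cong)
    have nor: "(norm_R R (D \<epsilon> u (?e n)))\<^sup>2 = (inverse \<epsilon>)\<^sup>2 * (norm_R R (dz z n))\<^sup>2"
      if "n \<in> S" for n
      unfolding norm_R_scale[symmetric] using norm_R_cong[of R, OF Du[OF that]] by simp
    define E where "E = (\<Sum>n\<in>S. bilin R (A \<epsilon> (?e n)) (dz z n) (dz z n))"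
    define H where "H = (\<Sum>n\<in>S. (norm_R R (dz z n))\<^sup>2)"
    define Z where "Z = (\<Sum>n | z n \<noteq> 0. (norm (z n))\<^sup>2)"
    have sumE: "(\<Sum>x\<in>sint R \<epsilon> \<Omega>. bilin R (A \<epsilon> x) (D \<epsilon> u x) (D \<epsilon> u x)) = (inverse \<epsilon>)\<^sup>2 * E"
      by (simp add: imS sum.reindex[OF inj] bil E_def sum_distrib_left)
    have h1: "(h1_norm R \<epsilon> \<Omega> u)\<^sup>2 = \<epsilon> ^ CARD('d) * ((inverse \<epsilon>)\<^sup>2 * H)"
      using e by (simp add: h1_norm_def imS sum.reindex[OF inj] nor H_def sum_distrib_left sum_nonneg)
    have "(\<Sum>n\<in>T. (norm (u (?e n)))\<^sup>2) = (\<Sum>n\<in>T. (norm (z n))\<^sup>2)"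
      by (rule sum.cong) (auto simp: T_def z_def dint_def)
    also have "\<dots> = Z"
      unfolding Z_def by (rule sum.mono_neutral_right[OF finT zT]) simp
    finally have l2: "(l2_norm R \<epsilon> \<Omega> u)\<^sup>2 = \<epsilon> ^ CARD('d) * Z"
      using e by (simp add: l2_norm_def imT sum.reindex[OF inj] sum_nonneg Z_def)
    have main: "E \<ge> lam1 / 2 * H - lam2 / s\<^sup>2 * Z"
      unfolding E_def H_def Z_def lam2_def
    proof (rule lattice_garding[OF assms(1,5,6) s finS finite_subset[OF zT finT] zS zS'])
      show "ereal lam1 \<le> lambda_atom R (A \<epsilon> (?e n))" "tensor_norm R (A \<epsilon> (?e n)) \<le> \<Lambda>"
        if "n \<in> S" for n
        using that stab bd eps by (auto simp: S_def)
      show "tensor_norm R (A \<epsilon> (?e n) - A \<epsilon> (?e n')) \<le> lam1 / 4"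
        if n: "n \<in> S" "n' \<in> S" "norm (real_vec n - real_vec n') \<le> 2 * s + 2 * R_max R" for n n'
      proof -
        have "norm (?e n - ?e n') = \<epsilon> * norm (real_vec n - real_vec n')"
          using e by (simp add: scaleR_diff_right[symmetric])
        also have "\<dots> \<le> \<epsilon> * (2 * s + 2 * R_max R)"
          using n(3) e by (intro mult_left_mono) auto
        finally have "norm (?e n - ?e n') \<le> 2 * r \<epsilon> + 2 * \<epsilon> * R_max R"
          by (simp add: r algebra_simps)
        then show ?thesis using osc eps n(1,2) by (simp add: S_def)
      qed
    qed
    have "\<epsilon> ^ CARD('d) * (inverse \<epsilon>)\<^sup>2 * (lam1 / 2 * H - lam2 / s\<^sup>2 * Z)
        \<le> \<epsilon> ^ CARD('d) * (inverse \<epsilon>)\<^sup>2 * E"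
      using main e by (intro mult_left_mono) auto
    then show "\<epsilon> ^ CARD('d) * (\<Sum>x\<in>sint R \<epsilon> \<Omega>. bilin R (A \<epsilon> x) (D \<epsilon> u x) (D \<epsilon> u x))
           \<ge> lam1 / 2 * (h1_norm R \<epsilon> \<Omega> u)\<^sup>2 - lam2 / (r \<epsilon>)\<^sup>2 * (l2_norm R \<epsilon> \<Omega> u)\<^sup>2"
      unfolding sumE h1 l2 r using e s by (simp add: field_simps)
  qed
qed

end
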